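(* Let $(A,S_A)$ and $(B,S_B)$ be marked groups of type $\mathsf{R}$. Then the free product $(A\ast B, S_A\cup S_B)$ is of type $\mathsf{R}$.
   Context: For a metric space $X$ and a real number $r\ge 0$, the Rips complex $R_r(X)$ is the simplicial complex whose simplices are the non-empty finite subsets of $X$ of diameter $\le r$. A marked group is a pair $(G,S)$, where $G$ is a finitely generated group and $S$ is a finite generating set of $G$. The group $G$ is equipped with the word metric $d_S$: $d_S(g,g)=0$ and, for $g\neq h$, $d_S(g,h)$ is the least $k\in\mathbb{N}$ such that $g^{-1}h=s_1\cdots s_k$ for some $s_1,\ldots,s_k\in S\cup S^{-1}$. Write $R_r(G,S)$ for the Rips complex $R_r(G,d_S)$. A marked group $(G,S)$ is of type $\mathsf{R}$ if there exists a real number $r_0\ge 0$ such that for all real $r\ge r_0$ the Rips complex $R_r(G,S)$ is contractible. In the free product, $A$ and $B$ are regarded as subgroups of $A\ast B$ via the canonical embeddings. *)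

theory Defs
  imports "HOL-Analysis.Analysis" "HOL-Algebra.Generated_Groups"
begin

section \<open>Simplicial complexes and their geometric realization\<close>

text \<open>
  An abstract simplicial complex is given by its set \<open>K\<close> of simplices (non-empty finite sets of
  vertices). Points of the realization are written in barycentric coordinates, as functions
  \<open>'v \<Rightarrow> real\<close>.
\<close>

definition face :: "'v set \<Rightarrow> ('v \<Rightarrow> real) set" where
  "face \<sigma> = {p. (\<forall>v. 0 \<le> p v) \<and> (\<forall>v. v \<notin> \<sigma> \<longrightarrow> p v = 0) \<and> (\<Sum>v\<in>\<sigma>. p v) = 1}"

text \<open>
  The realization carries the weak (coherent) topology: a set is open iff it meets each closed
  simplex in a relatively open set. As \<open>\<sigma>\<close> is finite, the topology that \<open>face \<sigma>\<close> inherits from the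
  product topology on \<open>'v \<Rightarrow> real\<close> is the Euclidean one.
\<close>

definition realization :: "'v set set \<Rightarrow> ('v \<Rightarrow> real) topology" where
  "realization K = topology (\<lambda>U. U \<subseteq> (\<Union>\<sigma>\<in>K. face \<sigma>) \<and>
     (\<forall>\<sigma>\<in>K. openin (top_of_set (face \<sigma>)) (U \<inter> face \<sigma>)))"

lemma openin_realization:
  "openin (realization K) U \<longleftrightarrow> U \<subseteq> (\<Union>\<sigma>\<in>K. face \<sigma>) \<and>
     (\<forall>\<sigma>\<in>K. openin (top_of_set (face \<sigma>)) (U \<inter> face \<sigma>))"
proof -
  have "istopology (\<lambda>U. U \<subseteq> (\<Union>\<sigma>\<in>K. face \<sigma>) \<and>
     (\<forall>\<sigma>\<in>K. openin (top_of_set (face \<sigma>)) (U \<inter> face \<sigma>)))" (is "istopology ?P")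
    unfolding istopology_def
  proof (intro conjI allI impI)
    fix S T assume *: "?P S" "?P T"
    then show "S \<inter> T \<subseteq> (\<Union>\<sigma>\<in>K. face \<sigma>)" by auto
    have eq: "S \<inter> T \<inter> face \<sigma> = (S \<inter> face \<sigma>) \<inter> (T \<inter> face \<sigma>)" for \<sigma> by auto
    show "\<forall>\<sigma>\<in>K. openin (top_of_set (face \<sigma>)) (S \<inter> T \<inter> face \<sigma>)"
      unfolding eq using * by (metis openin_Int)
  next
    fix \<K> assume *: "\<forall>U\<in>\<K>. ?P U"
    then show "\<Union>\<K> \<subseteq> (\<Union>\<sigma>\<in>K. face \<sigma>)" by auto
    have eq: "\<Union>\<K> \<inter> face \<sigma> = (\<Union>U\<in>\<K>. U \<inter> face \<sigma>)" for \<sigma> by auto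
    show "\<forall>\<sigma>\<in>K. openin (top_of_set (face \<sigma>)) (\<Union>\<K> \<inter> face \<sigma>)"
      unfolding eq using * by (intro ballI openin_Union) blast
  qed
  then show ?thesis by (simp add: realization_def)
qed

lemma topspace_realization: "topspace (realization K) = (\<Union>\<sigma>\<in>K. face \<sigma>)"
proof
  have "openin (realization K) (\<Union>\<sigma>\<in>K. face \<sigma>)"
    unfolding openin_realization
  proof (intro conjI ballI)
    fix \<sigma> assume "\<sigma> \<in> K"
    then have "(\<Union>\<sigma>\<in>K. face \<sigma>) \<inter> face \<sigma> = face \<sigma>" by auto
    then show "openin (top_of_set (face \<sigma>)) ((\<Union>\<sigma>\<in>K. face \<sigma>) \<inter> face \<sigma>)" by simp
  qed simp
  then show "(\<Union>\<sigma>\<in>K. face \<sigma>) \<subseteq> topspace (realization K)" by (rule openin_subset)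
  show "topspace (realization K) \<subseteq> (\<Union>\<sigma>\<in>K. face \<sigma>)"
    using openin_topspace openin_realization by metis
qed


section \<open>Rips complexes\<close>

definition diam :: "('v \<Rightarrow> 'v \<Rightarrow> real) \<Rightarrow> 'v set \<Rightarrow> real" where
  "diam d \<sigma> = (SUP (x, y)\<in>\<sigma> \<times> \<sigma>. d x y)"

definition rips :: "'v set \<Rightarrow> ('v \<Rightarrow> 'v \<Rightarrow> real) \<Rightarrow> real \<Rightarrow> 'v set set" where
  "rips X d r = {\<sigma>. \<sigma> \<noteq> {} \<and> finite \<sigma> \<and> \<sigma> \<subseteq> X \<and> diam d \<sigma> \<le> r}"


section \<open>Marked groups\<close>

definition marked_group :: "('a, 'm) monoid_scheme \<Rightarrow> 'a set \<Rightarrow> bool" where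
  "marked_group G S \<longleftrightarrow> group G \<and> finite S \<and> S \<subseteq> carrier G \<and> generate G S = carrier G"

definition word_dist :: "('a, 'm) monoid_scheme \<Rightarrow> 'a set \<Rightarrow> 'a \<Rightarrow> 'a \<Rightarrow> real" where
  "word_dist G S g h = (if g = h then 0 else
     real (LEAST k. \<exists>xs. length xs = k \<and> set xs \<subseteq> S \<union> m_inv G ` S \<and>
       inv\<^bsub>G\<^esub> g \<otimes>\<^bsub>G\<^esub> h = foldr (\<otimes>\<^bsub>G\<^esub>) xs \<one>\<^bsub>G\<^esub>))"

definition type_R :: "('a, 'm) monoid_scheme \<Rightarrow> 'a set \<Rightarrow> bool" where
  "type_R G S \<longleftrightarrow> marked_group G S \<and>
     (\<exists>r0\<ge>0. \<forall>r\<ge>r0. contractible_space (realization (rips (carrier G) (word_dist G S) r)))"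


section \<open>Free products\<close>

text \<open>
  Elements of the free product are the reduced words: alternating words in the non-trivial
  elements of the two factors.
\<close>

definition reduced_words ::
    "('a, 'm) monoid_scheme \<Rightarrow> ('b, 'n) monoid_scheme \<Rightarrow> ('a + 'b) list set" where
  "reduced_words A B = {w.
     set w \<subseteq> Inl ` (carrier A - {\<one>\<^bsub>A\<^esub>}) \<union> Inr ` (carrier B - {\<one>\<^bsub>B\<^esub>}) \<and>
     successively (\<lambda>x y. isl x \<noteq> isl y) w}"

definition free_inl :: "('a, 'm) monoid_scheme \<Rightarrow> 'a \<Rightarrow> ('a + 'b) list" where
  "free_inl A a = (if a = \<one>\<^bsub>A\<^esub> then [] else [Inl a])"

definition free_inr :: "('b, 'n) monoid_scheme \<Rightarrow> 'b \<Rightarrow> ('a + 'b) list" where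
  "free_inr B b = (if b = \<one>\<^bsub>B\<^esub> then [] else [Inr b])"

text \<open>
  The product of a single (possibly trivial) letter with a reduced word: the letter is merged with
  the first letter of the word if both come from the same factor.
\<close>

fun letter_mult :: "('a, 'm) monoid_scheme \<Rightarrow> ('b, 'n) monoid_scheme \<Rightarrow>
    'a + 'b \<Rightarrow> ('a + 'b) list \<Rightarrow> ('a + 'b) list" where
  "letter_mult A B (Inl a) (Inl a' # w) = free_inl A (a \<otimes>\<^bsub>A\<^esub> a') @ w"
| "letter_mult A B (Inr b) (Inr b' # w) = free_inr B (b \<otimes>\<^bsub>B\<^esub> b') @ w"
| "letter_mult A B (Inl a) w = free_inl A a @ w"
| "letter_mult A B (Inr b) w = free_inr B b @ w"

definition free_product ::
    "('a, 'm) monoid_scheme \<Rightarrow> ('b, 'n) monoid_scheme \<Rightarrow> ('a + 'b) list monoid" where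
  "free_product A B =
     \<lparr>carrier = reduced_words A B, mult = foldr (letter_mult A B), one = []\<rparr>"

text \<open>
  The following lemmas confirm that this is a group with the universal property of the
  coproduct, and that the canonical maps are injective homomorphisms.
\<close>

definition letters :: "('a, 'm) monoid_scheme \<Rightarrow> ('b, 'n) monoid_scheme \<Rightarrow> ('a + 'b) set" where
  "letters A B = Inl ` carrier A \<union> Inr ` carrier B"

lemma Nil_reduced [simp]: "[] \<in> reduced_words A B"
  by (simp add: reduced_words_def)

lemma reduced_Cons:
  "x # w \<in> reduced_words A B \<longleftrightarrow>
     x \<in> Inl ` (carrier A - {\<one>\<^bsub>A\<^esub>}) \<union> Inr ` (carrier B - {\<one>\<^bsub>B\<^esub>}) \<and>
     w \<in> reduced_words A B \<and> (w = [] \<or> isl x \<noteq> isl (hd w))"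
  by (cases w) (auto simp: reduced_words_def)

lemma letter_mult_closed:
  assumes "group A" "group B" "x \<in> letters A B" "w \<in> reduced_words A B"
  shows "letter_mult A B x w \<in> reduced_words A B"
proof -
  interpret A: group A by fact
  interpret B: group B by fact
  show ?thesis
    using assms(3,4)
    by (cases "(A, B, x, w)" rule: letter_mult.cases)
       (auto simp: reduced_Cons letters_def free_inl_def free_inr_def)
qed

lemma reduced_letters: "w \<in> reduced_words A B \<Longrightarrow> set w \<subseteq> letters A B"
  by (auto simp: reduced_words_def letters_def)

lemma foldr_letter_mult_closed:
  assumes "group A" "group B" "set u \<subseteq> letters A B" "w \<in> reduced_words A B"
  shows "foldr (letter_mult A B) u w \<in> reduced_words A B"
  using assms(3) by (induction u) (auto intro: letter_mult_closed assms)

lemma letter_mult_Inl_Inl: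
  assumes "group A" "group B" "a \<in> carrier A" "a' \<in> carrier A" "w \<in> reduced_words A B"
  shows "letter_mult A B (Inl a) (letter_mult A B (Inl a') w) =
    foldr (letter_mult A B) (free_inl A (a \<otimes>\<^bsub>A\<^esub> a')) w"
proof -
  interpret A: group A by fact
  show ?thesis
  proof (cases w)
    case Nil
    then show ?thesis using assms(3,4) by (auto simp: free_inl_def)
  next
    case (Cons x v)
    show ?thesis
    proof (cases x)
      case (Inl c)
      then have c: "c \<in> carrier A" "c \<noteq> \<one>\<^bsub>A\<^esub>" "v = [] \<or> (\<exists>b v'. v = Inr b # v')"
        using assms(5) Cons by (auto simp: reduced_Cons) (metis list.collapse sum.collapse(2))
      have "a \<otimes>\<^bsub>A\<^esub> (a' \<otimes>\<^bsub>A\<^esub> c) = (a \<otimes>\<^bsub>A\<^esub> a') \<otimes>\<^bsub>A\<^esub> c"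
        using c assms(3,4) by (simp add: A.m_assoc)
      then show ?thesis using c assms(3,4) Cons Inl
        by (auto simp: free_inl_def)
    next
      case (Inr b)
      then show ?thesis using assms(3,4) Cons by (auto simp: free_inl_def)
    qed
  qed
qed

lemma letter_mult_Inr_Inr:
  assumes "group A" "group B" "b \<in> carrier B" "b' \<in> carrier B" "w \<in> reduced_words A B"
  shows "letter_mult A B (Inr b) (letter_mult A B (Inr b') w) =
    foldr (letter_mult A B) (free_inr B (b \<otimes>\<^bsub>B\<^esub> b')) w"
proof -
  interpret B: group B by fact
  show ?thesis
  proof (cases w)
    case Nil
    then show ?thesis using assms(3,4) by (auto simp: free_inr_def)
  next
    case (Cons x v)
    show ?thesis
    proof (cases x)
      case (Inr c)
      then have c: "c \<in> carrier B" "c \<noteq> \<one>\<^bsub>B\<^esub>" "v = [] \<or> (\<exists>a v'. v = Inl a # v')"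
        using assms(5) Cons by (auto simp: reduced_Cons) (metis list.collapse sum.collapse(1))
      have "b \<otimes>\<^bsub>B\<^esub> (b' \<otimes>\<^bsub>B\<^esub> c) = (b \<otimes>\<^bsub>B\<^esub> b') \<otimes>\<^bsub>B\<^esub> c"
        using c assms(3,4) by (simp add: B.m_assoc)
      then show ?thesis using c assms(3,4) Cons Inr
        by (auto simp: free_inr_def)
    next
      case (Inl a)
      then show ?thesis using assms(3,4) Cons by (auto simp: free_inr_def)
    qed
  qed
qed

lemma foldr_free_inl:
  assumes "group A" "group B" "a \<in> carrier A" "w \<in> reduced_words A B"
  shows "foldr (letter_mult A B) (free_inl A a) w = letter_mult A B (Inl a) w"
proof -
  interpret A: group A by fact
  show ?thesis
    using assms(3,4) by (cases "(A, B, Inl a :: 'a + 'c, w)" rule: letter_mult.cases)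
      (auto simp: free_inl_def reduced_Cons)
qed

lemma foldr_free_inr:
  assumes "group A" "group B" "b \<in> carrier B" "w \<in> reduced_words A B"
  shows "foldr (letter_mult A B) (free_inr B b) w = letter_mult A B (Inr b) w"
proof -
  interpret B: group B by fact
  show ?thesis
    using assms(3,4) by (cases "(A, B, Inr b :: 'a + 'c, w)" rule: letter_mult.cases)
      (auto simp: free_inr_def reduced_Cons)
qed

lemma foldr_letter_mult:
  assumes "group A" "group B" "x \<in> letters A B" "u \<in> reduced_words A B" "w \<in> reduced_words A B"
  shows "foldr (letter_mult A B) (letter_mult A B x u) w =
    letter_mult A B x (foldr (letter_mult A B) u w)"
proof -
  have u: "set u \<subseteq> letters A B" using assms(4) by (rule reduced_letters)
  show ?thesis
    using assms(3) u
  proof (cases "(A, B, x, u)" rule: letter_mult.cases)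
    case (1 A' B' a a' v)
    then have "foldr (letter_mult A B) v w \<in> reduced_words A B"
      using u by (intro foldr_letter_mult_closed assms) auto
    with 1 u assms show ?thesis
      by (auto simp: letter_mult_Inl_Inl letters_def)
  next
    case (2 A' B' b b' v)
    then have "foldr (letter_mult A B) v w \<in> reduced_words A B"
      using u by (intro foldr_letter_mult_closed assms) auto
    with 2 u assms show ?thesis
      by (auto simp: letter_mult_Inr_Inr letters_def)
  qed (use assms u in \<open>auto simp: foldr_free_inl foldr_free_inr letters_def
         letter_mult_closed foldr_letter_mult_closed\<close>)
qed

lemma group_free_product:
  assumes "group A" "group B"
  shows "group (free_product A B)"
proof -
  interpret A: group A by fact
  interpret B: group B by fact
  have assoc: "foldr (letter_mult A B) (foldr (letter_mult A B) u v) w =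
      foldr (letter_mult A B) u (foldr (letter_mult A B) v w)"
    if "set u \<subseteq> letters A B" "v \<in> reduced_words A B" "w \<in> reduced_words A B" for u v w
    using that
    by (induction u) (auto simp: foldr_letter_mult assms foldr_letter_mult_closed)
  have linv: "\<exists>v\<in>reduced_words A B. foldr (letter_mult A B) v u = []"
    if "u \<in> reduced_words A B" for u
    using that
  proof (induction u)
    case (Cons x u)
    then obtain v where v: "v \<in> reduced_words A B" "foldr (letter_mult A B) v u = []"
      by (auto simp: reduced_Cons)
    obtain y where y: "y \<in> letters A B" "[y] \<in> reduced_words A B"
        "letter_mult A B y (x # u) = u"
    proof (cases x)
      case (Inl a)
      then have "a \<in> carrier A" "a \<noteq> \<one>\<^bsub>A\<^esub>" using Cons.prems by (auto simp: reduced_Cons)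
      with Inl show ?thesis
        by (intro that[of "Inl (inv\<^bsub>A\<^esub> a)"]) (auto simp: letters_def reduced_Cons free_inl_def)
    next
      case (Inr b)
      then have "b \<in> carrier B" "b \<noteq> \<one>\<^bsub>B\<^esub>" using Cons.prems by (auto simp: reduced_Cons)
      with Inr show ?thesis
        by (intro that[of "Inr (inv\<^bsub>B\<^esub> b)"]) (auto simp: letters_def reduced_Cons free_inr_def)
    qed
    let ?v = "foldr (letter_mult A B) v [y]"
    have "?v \<in> reduced_words A B"
      using v y by (intro foldr_letter_mult_closed assms reduced_letters)
    moreover have "foldr (letter_mult A B) ?v (x # u) = []"
      using v y Cons.prems by (subst assoc) (auto dest: reduced_letters)
    ultimately show ?case by blast
  qed (auto intro!: bexI[of _ "[]"])
  have nil: "foldr (letter_mult A B) u [] = u" if "u \<in> reduced_words A B" for u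
    using that
  proof (induction u)
    case (Cons x u)
    then show ?case
      by (cases x; cases u; cases "hd u") (auto simp: reduced_Cons free_inl_def free_inr_def)
  qed auto
  show ?thesis
    by (rule groupI)
       (auto simp: free_product_def assoc reduced_letters linv
         foldr_letter_mult_closed[OF assms])
qed

lemma free_inl_hom: "group A \<Longrightarrow> group B \<Longrightarrow> free_inl A \<in> hom A (free_product A B)"
  using group.is_monoid[of A]
  by (auto simp: hom_def free_product_def free_inl_def reduced_words_def monoid.m_closed
      monoid.l_one monoid.r_one)

lemma free_inr_hom: "group A \<Longrightarrow> group B \<Longrightarrow> free_inr B \<in> hom B (free_product A B)"
  using group.is_monoid[of B]
  by (auto simp: hom_def free_product_def free_inr_def reduced_words_def monoid.m_closed
      monoid.l_one monoid.r_one)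

lemma inj_free_inl: "inj (free_inl A)" and inj_free_inr: "inj (free_inr B)"
  by (auto simp: inj_def free_inl_def free_inr_def)

lemma free_product_universal:
  assumes "group A" "group B" "group H" "f \<in> hom A H" "g \<in> hom B H"
  shows "\<exists>h\<in>hom (free_product A B) H.
      (\<forall>a\<in>carrier A. h (free_inl A a) = f a) \<and> (\<forall>b\<in>carrier B. h (free_inr B b) = g b) \<and>
      (\<forall>h'\<in>hom (free_product A B) H.
        (\<forall>a\<in>carrier A. h' (free_inl A a) = f a) \<and> (\<forall>b\<in>carrier B. h' (free_inr B b) = g b) \<longrightarrow>
        (\<forall>w\<in>carrier (free_product A B). h' w = h w))"
proof -
  interpret A: group A by fact
  interpret B: group B by fact
  interpret H: group H by fact
  interpret P: group "free_product A B" using assms by (intro group_free_product)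
  interpret f: group_hom A H f by (simp add: assms group_hom_def group_hom_axioms_def)
  interpret g: group_hom B H g by (simp add: assms group_hom_def group_hom_axioms_def)
  define \<phi> where "\<phi> = case_sum f g"
  define h where "h w = foldr (\<lambda>x y. \<phi> x \<otimes>\<^bsub>H\<^esub> y) w \<one>\<^bsub>H\<^esub>" for w
  have \<phi>: "\<phi> x \<in> carrier H" if "x \<in> letters A B" for x
    using that by (auto simp: \<phi>_def letters_def)
  have h_in: "h w \<in> carrier H" if "set w \<subseteq> letters A B" for w
    using that by (induction w) (auto simp: h_def \<phi>)
  have h_Cons: "h (x # w) = \<phi> x \<otimes>\<^bsub>H\<^esub> h w" for x w by (simp add: h_def)
  have h_Nil: "h [] = \<one>\<^bsub>H\<^esub>" by (simp add: h_def)
  have h_inl: "h (free_inl A a @ w) = f a \<otimes>\<^bsub>H\<^esub> h w"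
    if "a \<in> carrier A" "set w \<subseteq> letters A B" for a w
    using that h_in by (auto simp: free_inl_def h_Cons \<phi>_def)
  have h_inr: "h (free_inr B b @ w) = g b \<otimes>\<^bsub>H\<^esub> h w"
    if "b \<in> carrier B" "set w \<subseteq> letters A B" for b w
    using that h_in by (auto simp: free_inr_def h_Cons \<phi>_def)
  have h_letter: "h (letter_mult A B x w) = \<phi> x \<otimes>\<^bsub>H\<^esub> h w"
    if "x \<in> letters A B" "set w \<subseteq> letters A B" for x w
    using that h_in
  proof (cases "(A, B, x, w)" rule: letter_mult.cases)
    case (1 A' B' a a' v)
    then have v: "a \<in> carrier A" "a' \<in> carrier A" "set v \<subseteq> letters A B"
      using that by (auto simp: letters_def)
    from 1 have "x = Inl a" "w = Inl a' # v" by auto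
    with v h_in[OF v(3)] show ?thesis by (simp add: h_inl h_Cons \<phi>_def H.m_assoc)
  next
    case (2 A' B' b b' v)
    then have v: "b \<in> carrier B" "b' \<in> carrier B" "set v \<subseteq> letters A B"
      using that by (auto simp: letters_def)
    from 2 have "x = Inr b" "w = Inr b' # v" by auto
    with v h_in[OF v(3)] show ?thesis by (simp add: h_inr h_Cons \<phi>_def H.m_assoc)
  qed (auto simp: letters_def h_Cons h_Nil \<phi>_def free_inl_def free_inr_def)
  have h_mult: "h (foldr (letter_mult A B) u w) = h u \<otimes>\<^bsub>H\<^esub> h w"
    if "set u \<subseteq> letters A B" "w \<in> reduced_words A B" for u w
    using that
  proof (induction u)
    case (Cons x u)
    then have "foldr (letter_mult A B) u w \<in> reduced_words A B"
      by (intro foldr_letter_mult_closed assms) auto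
    with Cons show ?case
      by (simp add: h_letter reduced_letters h_Cons H.m_assoc \<phi> h_in)
  qed (auto simp: h_Nil h_in reduced_letters)
  have "h \<in> hom (free_product A B) H"
    by (auto simp: hom_def free_product_def h_mult reduced_letters h_in)
  moreover have "h (free_inl A a) = f a" if "a \<in> carrier A" for a
    using h_inl[of a "[]"] that by (simp add: h_Nil)
  moreover have "h (free_inr B b) = g b" if "b \<in> carrier B" for b
    using h_inr[of b "[]"] that by (simp add: h_Nil)
  moreover have "h' w = h w"
    if h': "h' \<in> hom (free_product A B) H" "\<forall>a\<in>carrier A. h' (free_inl A a) = f a"
      "\<forall>b\<in>carrier B. h' (free_inr B b) = g b" and w: "w \<in> reduced_words A B" for h' w
    using w
  proof (induction w)
    case Nil
    have "h' (\<one>\<^bsub>free_product A B\<^esub>) = \<one>\<^bsub>H\<^esub>"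
      using h'(1) P.group_axioms assms(3) hom_one by blast
    then show ?case by (simp add: h_Nil free_product_def)
  next
    case (Cons x w)
    then have x: "[x] \<in> reduced_words A B" "w \<in> reduced_words A B" by (auto simp: reduced_Cons)
    have "x # w = [x] \<otimes>\<^bsub>free_product A B\<^esub> w"
      using Cons.prems
      by (cases x; cases w; cases "hd w")
         (auto simp: free_product_def reduced_Cons free_inl_def free_inr_def)
    then have "h' (x # w) = h' ([x] \<otimes>\<^bsub>free_product A B\<^esub> w)" by (rule arg_cong)
    also have "\<dots> = h' [x] \<otimes>\<^bsub>H\<^esub> h' w"
      using h'(1) x by (intro hom_mult) (auto simp: free_product_def)
    also have "h' [x] = \<phi> x"
    proof (cases x)
      case (Inl a)
      then have "a \<in> carrier A" "free_inl A a = [x]"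
        using x by (auto simp: reduced_Cons free_inl_def)
      then show ?thesis using h'(2) Inl by (metis \<phi>_def sum.case(1))
    next
      case (Inr b)
      then have "b \<in> carrier B" "free_inr B b = [x]"
        using x by (auto simp: reduced_Cons free_inr_def)
      then show ?thesis using h'(3) Inr by (metis \<phi>_def sum.case(2))
    qed
    also have "h' w = h w" using Cons.IH x by simp
    finally show ?case by (simp only: h_Cons)
  qed
  moreover have "carrier (free_product A B) = reduced_words A B" by (simp add: free_product_def)
  ultimately show ?thesis by blast
qed

end

theory Submission
  imports Defs
begin

text \<open>
  Let \<open>X n\<close> be the set of reduced words with at most \<open>n\<close> syllables. Appending a syllable to a word \<open>w\<close>
  of length \<open>n\<close> attaches to \<open>X n\<close>, at the point \<open>w\<close>, an isometric copy of a factor, and every geodesic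
  leaving the copy passes through \<open>w\<close>: the word norm of the free product is the sum of the norms of the
  syllables. Hence in a simplex of the Rips complex that meets several pieces, the mass lying in a piece
  may be pushed to its base point; afterwards at most one piece is involved at each point, and it can be
  contracted to its base point within its own Rips complex. So the Rips complex of \<open>X (n + 1)\<close> deforms
  into that of \<open>X n\<close>, relative to the latter. Running the \<open>n\<close>-th of these deformations in the time
  interval from \<open>1/(n+3)\<close> to \<open>1/(n+2)\<close> contracts the union to the single vertex \<open>X 0\<close>.
\<close>

section \<open>Geometric realizations\<close>

text \<open>The scale \<open>r\<close> is never enlarged: every piece is isometric to a factor at
  the same \<open>r\<close>, so the larger of the two thresholds serves the free product. Two
  obstacles shape the argument. If a simplex has a vertex in a piece and one outside, the base point
  is within \<open>r\<close> of all its vertices and may be adjoined. If the simplex lies wholly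
  inside the piece, nothing bounds its distance from the base point. Every push is therefore
  weighted by the mass in the piece, and is the identity once that mass is 1. Secondly, a
  contraction of a factor may move the base point, whereas infinitely many deformations can be
  strung together only if each fixes the earlier stage pointwise. The weak topology makes this
  manageable: since the interval is locally compact, homotopies too may be tested on one closed
  simplex at a time. Infinitely many pieces and infinitely many stages are then glued without any
  estimate, since a single simplex sees only finitely much of them.\<close>

definition abstract_complex :: "'v set set \<Rightarrow> bool" where
  "abstract_complex K \<longleftrightarrow> (\<forall>\<sigma>\<in>K. finite \<sigma> \<and> \<sigma> \<noteq> {} \<and> (\<forall>\<tau>\<subseteq>\<sigma>. \<tau> \<noteq> {} \<longrightarrow> \<tau> \<in> K))"

lemma abstract_complexD:
  assumes "abstract_complex K" "\<sigma> \<in> K"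
  shows "finite \<sigma>" "\<sigma> \<noteq> {}" "\<tau> \<subseteq> \<sigma> \<Longrightarrow> \<tau> \<noteq> {} \<Longrightarrow> \<tau> \<in> K"
  using assms unfolding abstract_complex_def by blast+

section \<open>Closed simplices in barycentric coordinates\<close>

lemma face_mono:
  assumes "finite \<tau>" "\<sigma> \<subseteq> \<tau>"
  shows "face \<sigma> \<subseteq> face \<tau>"
proof
  fix p assume p: "p \<in> face \<sigma>"
  have "(\<Sum>v\<in>\<sigma>. p v) = (\<Sum>v\<in>\<tau>. p v)"
    using p assms by (intro sum.mono_neutral_left) (auto simp: face_def)
  with p assms show "p \<in> face \<tau>" by (auto simp: face_def)
qed

lemma face_support:
  assumes "finite \<sigma>" "p \<in> face \<sigma>" "\<And>v. v \<in> \<sigma> \<Longrightarrow> v \<notin> \<tau> \<Longrightarrow> p v = 0" "finite \<tau>"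
  shows "p \<in> face \<tau>"
proof -
  have "(\<Sum>v\<in>\<sigma>. p v) = (\<Sum>v\<in>\<sigma> \<inter> \<tau>. p v)" using assms
    by (intro sum.mono_neutral_right) auto
  also have "\<dots> = (\<Sum>v\<in>\<tau>. p v)"
    using assms by (intro sum.mono_neutral_left) (auto simp: face_def)
  finally show ?thesis using assms by (auto simp: face_def)
qed

lemma face_nonempty_support: "p \<in> face \<sigma> \<Longrightarrow> {v\<in>\<sigma>. p v \<noteq> 0} \<noteq> {}"
proof
  assume p: "p \<in> face \<sigma>" and "{v\<in>\<sigma>. p v \<noteq> 0} = {}"
  then have "(\<Sum>v\<in>\<sigma>. p v) = 0" by (intro sum.neutral) auto
  with p show False by (simp add: face_def)
qed

lemma face_Int:
  assumes "finite \<sigma>" "finite \<tau>"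
  shows "face \<sigma> \<inter> face \<tau> = face (\<sigma> \<inter> \<tau>)"
proof
  show "face (\<sigma> \<inter> \<tau>) \<subseteq> face \<sigma> \<inter> face \<tau>"
    using assms by (simp add: face_mono)
  show "face \<sigma> \<inter> face \<tau> \<subseteq> face (\<sigma> \<inter> \<tau>)"
    using assms by (auto intro!: face_support[of \<sigma>]) (auto simp: face_def)
qed

lemma face_singleton: "face {v} = {\<lambda>w. if w = v then 1 else 0}"
proof
  show "face {v} \<subseteq> {\<lambda>w. if w = v then 1 else 0}"
    by (rule subsetI) (simp add: face_def fun_eq_iff)
qed (simp add: face_def)

lemma closedin_face:
  assumes "finite \<sigma>" "\<tau> \<subseteq> \<sigma>"
  shows "closedin (top_of_set (face \<sigma>)) (face \<tau>)"
proof -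
  have "face \<tau> = face \<sigma> \<inter> (\<Inter>v\<in>\<sigma> - \<tau>. {p. p v = 0})"
  proof
    show "face \<tau> \<subseteq> face \<sigma> \<inter> (\<Inter>v\<in>\<sigma> - \<tau>. {p. p v = 0})"
      using face_mono[OF assms] by (auto simp: face_def)
    show "face \<sigma> \<inter> (\<Inter>v\<in>\<sigma> - \<tau>. {p. p v = 0}) \<subseteq> face \<tau>"
      using assms by (auto intro!: face_support[of \<sigma>] intro: finite_subset)
  qed
  moreover have "closed (\<Inter>v\<in>\<sigma> - \<tau>. {p :: 'a \<Rightarrow> real. p v = 0})"
    by (intro closed_INT ballI closed_Collect_eq continuous_on_product_coordinates continuous_intros)
  ultimately show ?thesis by (auto simp: closedin_closed)
qed

lemma closedin_realization:
  "closedin (realization K) C \<longleftrightarrow> C \<subseteq> (\<Union>\<sigma>\<in>K. face \<sigma>) \<and>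
     (\<forall>\<sigma>\<in>K. closedin (top_of_set (face \<sigma>)) (C \<inter> face \<sigma>))"
proof -
  have "((\<Union>\<sigma>\<in>K. face \<sigma>) - C) \<inter> face \<sigma> = face \<sigma> - (C \<inter> face \<sigma>)" if "\<sigma> \<in> K" for \<sigma>
    using that by auto
  then show ?thesis
    by (auto simp: closedin_def topspace_realization openin_realization)
qed

text \<open>The comparison is made with closed sets: a set closed in the subcomplex meets a simplex
  of \<open>K\<close> in the union of its traces on the finitely many faces belonging to
  \<open>L\<close>, and a finite union of closed sets is closed. An open set of the subcomplex would
  first have to be thickened to one of \<open>K\<close>.\<close>

lemma subtopology_realization:
  assumes K: "abstract_complex K" and L: "abstract_complex L" "L \<subseteq> K"
  shows "subtopology (realization K) (\<Union>\<sigma>\<in>L. face \<sigma>) = realization L"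
proof -
  let ?L = "\<Union>\<sigma>\<in>L. face \<sigma>"
  have "closedin (subtopology (realization K) ?L) C = closedin (realization L) C" for C
  proof
    assume "closedin (subtopology (realization K) ?L) C"
    then obtain D where D: "closedin (realization K) D" "C = D \<inter> ?L"
      by (auto simp: closedin_subtopology)
    have "C \<inter> face \<sigma> = D \<inter> face \<sigma>" if "\<sigma> \<in> L" for \<sigma>
      using D(2) that by auto
    with D L(2) show "closedin (realization L) C"
      by (simp add: closedin_realization subset_iff)
  next
    assume C: "closedin (realization L) C"
    have "closedin (realization K) C"
      unfolding closedin_realization
    proof (intro conjI ballI)
      show "C \<subseteq> (\<Union>\<sigma>\<in>K. face \<sigma>)"
        using C L(2) unfolding closedin_realization by blast
      fix \<sigma> assume \<sigma>: "\<sigma> \<in> K"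
      then have fin: "finite \<sigma>" by (rule abstract_complexD(1)[OF K])
      have "C \<inter> face \<sigma> = (\<Union>\<rho>\<in>{\<rho>\<in>L. \<rho> \<subseteq> \<sigma>}. C \<inter> face \<rho>)"
      proof
        show "(\<Union>\<rho>\<in>{\<rho>\<in>L. \<rho> \<subseteq> \<sigma>}. C \<inter> face \<rho>) \<subseteq> C \<inter> face \<sigma>"
          using face_mono[OF fin] by auto
        show "C \<inter> face \<sigma> \<subseteq> (\<Union>\<rho>\<in>{\<rho>\<in>L. \<rho> \<subseteq> \<sigma>}. C \<inter> face \<rho>)"
        proof
          fix p assume p: "p \<in> C \<inter> face \<sigma>"
          then obtain \<tau> where \<tau>: "\<tau> \<in> L" "p \<in> face \<tau>"
            using C by (auto simp: closedin_realization)
          then have "p \<in> face (\<sigma> \<inter> \<tau>)"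
            using p fin abstract_complexD(1)[OF L(1)] by (simp add: face_Int[symmetric])
          moreover from this have "\<sigma> \<inter> \<tau> \<noteq> {}" using face_nonempty_support by fastforce
          then have "\<sigma> \<inter> \<tau> \<in> L" using abstract_complexD(3)[OF L(1) \<tau>(1)] by auto
          ultimately show "p \<in> (\<Union>\<rho>\<in>{\<rho>\<in>L. \<rho> \<subseteq> \<sigma>}. C \<inter> face \<rho>)"
            using p by blast
        qed
      qed
      moreover have "closedin (top_of_set (face \<sigma>)) (C \<inter> face \<rho>)" if "\<rho> \<in> L" "\<rho> \<subseteq> \<sigma>" for \<rho>
      proof (rule closedin_trans)
        show "closedin (top_of_set (face \<rho>)) (C \<inter> face \<rho>)"
          using C that(1) unfolding closedin_realization by blast
      qed (rule closedin_face[OF fin that(2)])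
      moreover have "finite {\<rho>\<in>L. \<rho> \<subseteq> \<sigma>}"
        using fin by (auto intro: finite_subset[of _ "Pow \<sigma>"])
      ultimately show "closedin (top_of_set (face \<sigma>)) (C \<inter> face \<sigma>)"
        by (smt (verit) closedin_Union finite_imageI imageE mem_Collect_eq)
    qed
    moreover have "C \<subseteq> ?L" using C by (simp add: closedin_realization)
    ultimately show "closedin (subtopology (realization K) ?L) C"
      by (auto simp: closedin_subtopology)
  qed
  then have cl: "closedin (subtopology (realization K) ?L) = closedin (realization L)" by blast
  have "topspace (subtopology (realization K) ?L) = topspace (realization L)"
    using L(2) by (auto simp: topspace_realization)
  with cl have "openin (subtopology (realization K) ?L) U = openin (realization L) U" for U
    unfolding openin_closedin_eq by simp
  then show ?thesis by (simp add: topology_eq)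
qed

section \<open>Continuity of maps out of and into a realization\<close>

lemma quotient_map_realization:
  "quotient_map (sum_topology (\<lambda>\<sigma>. top_of_set (face \<sigma>)) K) (realization K) snd"
  unfolding quotient_map_def
proof (intro conjI allI impI)
  show "snd ` topspace (sum_topology (\<lambda>\<sigma>. top_of_set (face \<sigma>)) K) = topspace (realization K)"
    by (force simp: topspace_realization)
  fix U assume U: "U \<subseteq> topspace (realization K)"
  have "{x. (\<sigma>, x) \<in> {x \<in> Sigma K face. snd x \<in> U}} = U \<inter> face \<sigma>" if "\<sigma> \<in> K" for \<sigma>
    using that by auto
  then show "openin (sum_topology (\<lambda>\<sigma>. top_of_set (face \<sigma>)) K)
      {x \<in> topspace (sum_topology (\<lambda>\<sigma>. top_of_set (face \<sigma>)) K). snd x \<in> U} =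
    openin (realization K) U"
    using U unfolding openin_sum_topology openin_realization topspace_realization
    by (auto simp: o_def)
qed

text \<open>The product topology need not be the weak one determined by the sets Z times simplex. It
  is for locally compact Hausdorff \<open>Z\<close>, because the product of a quotient map with the
  identity of \<open>Z\<close> is again a quotient map. With \<open>Z\<close> the unit interval,
  every homotopy below is checked one simplex at a time.\<close>

lemma continuous_map_prod_realization:
  assumes Z: "locally_compact_space Z" "Hausdorff_space Z"
    and f: "\<And>\<sigma>. \<sigma> \<in> K \<Longrightarrow> continuous_map (prod_topology Z (top_of_set (face \<sigma>))) Y f"
  shows "continuous_map (prod_topology Z (realization K)) Y f"
proof -
  let ?S = "sum_topology (\<lambda>\<sigma>. top_of_set (face \<sigma>)) K"
  have "quotient_map (prod_topology Z ?S) (prod_topology Z (realization K)) (\<lambda>(x,y). (x, snd y))"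
    using Z quotient_map_realization by (intro quotient_map_prod_right) auto
  moreover have "continuous_map (prod_topology Z ?S) Y (f \<circ> (\<lambda>(x,y). (x, snd y)))"
    unfolding continuous_map_def
  proof (intro conjI allI impI)
    show "f \<circ> (\<lambda>(x,y). (x, snd y)) \<in> topspace (prod_topology Z ?S) \<rightarrow> topspace Y"
      using f by (fastforce simp: continuous_map_def Pi_iff)
    fix U assume U: "openin Y U"
    let ?W = "{x \<in> topspace (prod_topology Z ?S). (f \<circ> (\<lambda>(x,y). (x, snd y))) x \<in> U}"
    show "openin (prod_topology Z ?S) ?W"
      unfolding openin_prod_topology_alt
    proof (intro allI impI)
      fix t y assume "(t, y) \<in> ?W"
      then obtain \<sigma> p where y: "y = (\<sigma>, p)" "\<sigma> \<in> K" "p \<in> face \<sigma>" "t \<in> topspace Z" "f (t, p) \<in> U"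
        by (cases y) auto
      \<comment> \<open>The sheets of the disjoint union are open in it, so an open box found in the
        sheet of \<sigma> is already an open box of the whole product.\<close>
      define V where "V = {x \<in> topspace (prod_topology Z (top_of_set (face \<sigma>))). f x \<in> U}"
      have V: "openin (prod_topology Z (top_of_set (face \<sigma>))) V" "(t, p) \<in> V"
        using f[OF y(2)] U y by (simp_all add: continuous_map_def V_def)
      obtain A B where AB: "openin Z A" "openin (top_of_set (face \<sigma>)) B" "t \<in> A" "p \<in> B"
          "A \<times> B \<subseteq> V"
        using iffD1[OF openin_prod_topology_alt V(1), rule_format, OF V(2)] by metis
      have "openin ?S (Pair \<sigma> ` B)"
        using open_map_component_injection[OF y(2), of "\<lambda>\<sigma>. top_of_set (face \<sigma>)"] AB(2)
        by (simp add: open_map_def)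
      moreover have "A \<times> Pair \<sigma> ` B \<subseteq> ?W" using AB(5) y(2) by (auto simp: V_def)
      ultimately show "\<exists>A B. openin Z A \<and> openin ?S B \<and> t \<in> A \<and> y \<in> B \<and> A \<times> B \<subseteq> ?W"
        using AB y(1) by blast
    qed
  qed
  ultimately show ?thesis
    using continuous_compose_quotient_map[where g = f] by blast
qed

lemma continuous_map_realization:
  assumes f: "\<And>\<sigma>. \<sigma> \<in> K \<Longrightarrow> continuous_map (top_of_set (face \<sigma>)) Y f"
  shows "continuous_map (realization K) Y f"
  unfolding continuous_map_def
proof (intro conjI allI impI)
  have "f p \<in> topspace Y" if "\<sigma> \<in> K" "p \<in> face \<sigma>" for \<sigma> p
    using continuous_map_image_subset_topspace[OF f[OF that(1)]] that(2) by auto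
  then show "f \<in> topspace (realization K) \<rightarrow> topspace Y"
    unfolding topspace_realization by blast
  fix U assume U: "openin Y U"
  have "{p \<in> \<Union> (face ` K). f p \<in> U} \<inter> face \<sigma> = {p \<in> face \<sigma>. f p \<in> U}" if "\<sigma> \<in> K" for \<sigma>
    using that by blast
  moreover have "openin (top_of_set (face \<sigma>)) {p \<in> face \<sigma>. f p \<in> U}" if "\<sigma> \<in> K" for \<sigma>
    using openin_continuous_map_preimage[OF f[OF that] U] by simp
  ultimately show "openin (realization K) {p \<in> topspace (realization K). f p \<in> U}"
    unfolding topspace_realization openin_realization by auto
qed

lemma continuous_map_face_realization:
  assumes "\<sigma> \<in> K"
  shows "continuous_map (top_of_set (face \<sigma>)) (realization K) id"
  unfolding continuous_map_def
proof (intro conjI allI impI)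
  show "id \<in> topspace (top_of_set (face \<sigma>)) \<rightarrow> topspace (realization K)"
    using assms by (auto simp: topspace_realization)
  fix U assume "openin (realization K) U"
  then have "openin (top_of_set (face \<sigma>)) (U \<inter> face \<sigma>)"
    using assms by (simp add: openin_realization)
  then show "openin (top_of_set (face \<sigma>)) {x \<in> topspace (top_of_set (face \<sigma>)). id x \<in> U}"
    by (simp add: Int_def conj_commute)
qed

text \<open>The weak topology induces the product topology on a closed simplex. A map carried by a
  single simplex can therefore be checked coordinate by coordinate, which fails for maps that spread
  over infinitely many simplices.\<close>

lemma continuous_map_into_realization:
  assumes "\<sigma> \<in> K" "continuous_map X (top_of_set (face \<sigma>)) f"
  shows "continuous_map X (realization K) f"
  using continuous_map_compose[OF assms(2) continuous_map_face_realization[OF assms(1)]] by simp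

section \<open>Convexity and straight-line homotopies\<close>

lemma face_convex:
  assumes "p \<in> face \<tau>" "q \<in> face \<tau>" "0 \<le> t" "t \<le> 1"
  shows "(\<lambda>v. (1 - t) * p v + t * q v) \<in> face \<tau>"
proof -
  have "(\<Sum>v\<in>\<tau>. (1 - t) * p v + t * q v) = (1 - t) * (\<Sum>v\<in>\<tau>. p v) + t * (\<Sum>v\<in>\<tau>. q v)"
    by (simp add: sum.distrib sum_distrib_left)
  with assms show ?thesis by (simp add: face_def)
qed

lemma continuous_on_coordinate: "continuous_on S (\<lambda>p :: 'a \<Rightarrow> real. p v)"
  by (rule continuous_on_subset[OF continuous_on_product_coordinates]) simp

lemma prod_top_of_set: "prod_topology (top_of_set S) (top_of_set T) = top_of_set (S \<times> T)"
  by (simp add: subtopology_Times[symmetric])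

text \<open>The common simplex \<tau> serves twice: it contains the segment from each point of
  \<open>face \<sigma>\<close> to its image, and it carries the homotopy over
  \<open>face \<sigma>\<close>, so that continuity is a matter of coordinates. A segment from a
  fixed point to itself is constant, hence \<open>T\<close> stays fixed.\<close>

lemma straight_line_homotopy:
  assumes K: "abstract_complex K"
    and cont: "\<And>\<sigma>. \<sigma> \<in> K \<Longrightarrow> continuous_on (face \<sigma>) f"
    and carr: "\<And>\<sigma>. \<sigma> \<in> K \<Longrightarrow> \<exists>\<tau>\<in>K. \<sigma> \<subseteq> \<tau> \<and> f ` face \<sigma> \<subseteq> face \<tau>"
    and fixed: "\<And>x. x \<in> T \<Longrightarrow> f x = x"
  shows "homotopic_with (\<lambda>g. \<forall>x\<in>T. g x = x) (realization K) (realization K) id f"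
proof -
  define h where "h = (\<lambda>x v. (1 - fst x) * snd x v + fst x * f (snd x) v)"
  have "continuous_map (prod_topology (top_of_set {0..1}) (realization K)) (realization K) h"
  proof (rule continuous_map_prod_realization)
    show "locally_compact_space (top_of_set {0..1::real})"
      by (simp add: compact_imp_locally_compact_space compact_space_subtopology)
    show "Hausdorff_space (top_of_set {0..1::real})"
      by (simp add: Hausdorff_space_subtopology)
    fix \<sigma> assume \<sigma>: "\<sigma> \<in> K"
    then obtain \<tau> where \<tau>: "\<tau> \<in> K" "\<sigma> \<subseteq> \<tau>" "f ` face \<sigma> \<subseteq> face \<tau>" using carr by blast
    have sub: "face \<sigma> \<subseteq> face \<tau>"
      using \<tau> abstract_complexD(1)[OF K] by (simp add: face_mono)
    have "continuous_on ({0..1} \<times> face \<sigma>) (\<lambda>x. f (snd x))"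
      by (rule continuous_on_compose2[OF cont[OF \<sigma>]]) (auto intro: continuous_intros)
    then have f: "continuous_on ({0..1} \<times> face \<sigma>) (\<lambda>x. f (snd x) v)" for v
      by (rule continuous_on_product_then_coordinatewise)
    have p: "continuous_on ({0..1} \<times> face \<sigma>) (\<lambda>x. snd x v)" for v
      by (rule continuous_on_compose2[OF continuous_on_coordinate[of UNIV]])
         (auto intro: continuous_intros)
    have "continuous_on ({0..1} \<times> face \<sigma>) (\<lambda>x. h x v)" for v
      unfolding h_def by (intro continuous_on_add continuous_on_mult continuous_on_diff
          continuous_on_const continuous_on_fst continuous_on_id f p)
    then have "continuous_on ({0..1} \<times> face \<sigma>) h"
      by (rule continuous_on_coordinatewise_then_product)
    moreover have "h ` ({0..1} \<times> face \<sigma>) \<subseteq> face \<tau>"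
      using \<tau>(3) sub by (auto simp: h_def intro!: face_convex)
    ultimately show "continuous_map (prod_topology (top_of_set {0..1}) (top_of_set (face \<sigma>)))
        (realization K) h"
      by (intro continuous_map_into_realization[OF \<tau>(1)])
         (simp add: prod_top_of_set image_subset_iff_funcset)
  qed
  then show ?thesis
    unfolding homotopic_with_def
    by (intro exI[of _ h]) (auto simp: h_def fixed algebra_simps)
qed

text \<open>The sum runs over the support because \<open>Y\<close> may be infinite, where a plain
  sum over \<open>Y\<close> would be 0 by convention; points of a realization have finite
  support.\<close>

definition mass :: "'v set \<Rightarrow> ('v \<Rightarrow> real) \<Rightarrow> real" where
  "mass Y p = (\<Sum>v | v \<in> Y \<and> p v \<noteq> 0. p v)"

lemma mass_face: "finite \<sigma> \<Longrightarrow> p \<in> face \<sigma> \<Longrightarrow> mass Y p = (\<Sum>v\<in>\<sigma> \<inter> Y. p v)"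
  unfolding mass_def by (rule sum.mono_neutral_left) (auto simp: face_def)

lemma continuous_on_mass:
  assumes "finite \<sigma>"
  shows "continuous_on (face \<sigma>) (mass Y)"
proof -
  have "continuous_on (face \<sigma>) (\<lambda>p. \<Sum>v\<in>\<sigma> \<inter> Y. p v)"
    by (intro continuous_on_sum continuous_on_coordinate)
  then show ?thesis
    by (rule continuous_on_eq) (simp add: mass_face[OF assms])
qed

lemma mass_nonneg: "p \<in> face \<sigma> \<Longrightarrow> 0 \<le> mass Y p"
  by (auto simp: mass_def face_def intro: sum_nonneg)

lemma mass_Un_le_1:
  assumes "finite \<sigma>" "p \<in> face \<sigma>" "Y \<inter> Z = {}"
  shows "mass Y p + mass Z p \<le> 1"
proof -
  have "mass Y p + mass Z p = (\<Sum>v\<in>\<sigma> \<inter> Y \<union> \<sigma> \<inter> Z. p v)"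
    using assms by (subst sum.union_disjoint) (auto simp: mass_face)
  also have "\<dots> \<le> (\<Sum>v\<in>\<sigma>. p v)"
    using assms by (intro sum_mono2) (auto simp: face_def)
  finally show ?thesis using assms by (simp add: face_def)
qed

lemma mass_le_1: "finite \<sigma> \<Longrightarrow> p \<in> face \<sigma> \<Longrightarrow> mass Y p \<le> 1"
  using mass_Un_le_1[of \<sigma> p Y "{}"] by (simp add: mass_def)

lemma mass_eq_0_iff: "finite \<sigma> \<Longrightarrow> p \<in> face \<sigma> \<Longrightarrow> mass Y p = 0 \<longleftrightarrow> (\<forall>v\<in>Y. p v = 0)"
  by (subst mass_face, assumption+, subst sum_nonneg_eq_0_iff) (auto simp: face_def)

lemma mass_eq_1:
  assumes "finite \<sigma>" "p \<in> face \<sigma>" "\<And>v. p v \<noteq> 0 \<Longrightarrow> v \<in> Y"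
  shows "mass Y p = 1"
proof -
  have "(\<Sum>v\<in>\<sigma> \<inter> Y. p v) = (\<Sum>v\<in>\<sigma>. p v)"
    using assms by (intro sum.mono_neutral_left) auto
  with assms show ?thesis by (simp add: mass_face face_def)
qed

text \<open>Transport of weight: the vertex \<open>v\<close> keeps the fraction \<open>c v\<close>
  of its weight and hands the rest to \<open>q v\<close>. In the applications \<open>c\<close>
  depends on the point \<open>p\<close> as well, so the resulting map is not simplicial.\<close>

definition push :: "('v \<Rightarrow> 'v) \<Rightarrow> ('v \<Rightarrow> real) \<Rightarrow> ('v \<Rightarrow> real) \<Rightarrow> 'v \<Rightarrow> real" where
  "push q c p = (\<lambda>w. c w * p w + (\<Sum>v | p v \<noteq> 0 \<and> q v = w. (1 - c v) * p v))"

text \<open>On a fixed simplex the range of summation no longer depends on \<open>p\<close>, which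
  makes continuity in \<open>p\<close> visible.\<close>

lemma push_face:
  assumes "finite \<sigma>" "p \<in> face \<sigma>"
  shows "push q c p w = c w * p w + (\<Sum>v | v \<in> \<sigma> \<and> q v = w. (1 - c v) * p v)"
proof -
  have "(\<Sum>v | p v \<noteq> 0 \<and> q v = w. (1 - c v) * p v) = (\<Sum>v | v \<in> \<sigma> \<and> q v = w. (1 - c v) * p v)"
    using assms by (intro sum.mono_neutral_left) (auto simp: face_def)
  then show ?thesis by (simp add: push_def)
qed

lemma push_in_face:
  assumes \<sigma>: "finite \<sigma>" "p \<in> face \<sigma>" and \<tau>: "finite \<tau>" "\<sigma> \<subseteq> \<tau>" "q ` \<sigma> \<subseteq> \<tau>"
    and c: "\<And>v. 0 \<le> c v" "\<And>v. c v \<le> 1"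
  shows "push q c p \<in> face \<tau>"
proof -
  have p: "0 \<le> p v" for v using \<sigma> by (simp add: face_def)
  have p0: "p v = 0" if "v \<notin> \<sigma>" for v using \<sigma> that by (simp add: face_def)
  have "0 \<le> push q c p w" for w
    using c p by (auto simp: push_def intro!: add_nonneg_nonneg sum_nonneg mult_nonneg_nonneg)
  moreover have "push q c p w = 0" if "w \<notin> \<tau>" for w
  proof -
    have E: "{v. v \<in> \<sigma> \<and> q v = w} = {}" and "w \<notin> \<sigma>" using that \<tau> by auto
    then show ?thesis using p0 unfolding push_face[OF \<sigma>] E by simp
  qed
  moreover have "(\<Sum>w\<in>\<tau>. push q c p w) = 1"
  proof -
    have "(\<Sum>w\<in>\<tau>. push q c p w) =
        (\<Sum>w\<in>\<tau>. c w * p w) + (\<Sum>w\<in>\<tau>. \<Sum>v | v \<in> \<sigma> \<and> q v = w. (1 - c v) * p v)"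
      by (simp add: push_face[OF \<sigma>] sum.distrib)
    \<comment> \<open>Grouping by receiver: each vertex of \<sigma> gives to exactly one vertex of
      \<tau>.\<close>
    also have "(\<Sum>w\<in>\<tau>. \<Sum>v | v \<in> \<sigma> \<and> q v = w. (1 - c v) * p v) = (\<Sum>v\<in>\<sigma>. (1 - c v) * p v)"
      by (rule sum.group) (use \<sigma> \<tau> in auto)
    also have "(\<Sum>w\<in>\<tau>. c w * p w) = (\<Sum>v\<in>\<sigma>. c v * p v)"
      using \<tau> p0 by (intro sum.mono_neutral_right) auto
    also have "\<dots> + (\<Sum>v\<in>\<sigma>. (1 - c v) * p v) = (\<Sum>v\<in>\<sigma>. p v)"
      by (simp add: sum.distrib[symmetric] algebra_simps)
    finally show ?thesis using \<sigma> by (simp add: face_def)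
  qed
  ultimately show ?thesis by (auto simp: face_def)
qed

lemma push_support:
  assumes "push q c p w \<noteq> 0"
  obtains "c w \<noteq> 0" "p w \<noteq> 0" | v where "p v \<noteq> 0" "c v \<noteq> 1" "q v = w"
proof (cases "c w = 0 \<or> p w = 0")
  case True
  then have "(\<Sum>v | p v \<noteq> 0 \<and> q v = w. (1 - c v) * p v) \<noteq> 0"
    using assms by (auto simp: push_def)
  then obtain v where "v \<in> {v. p v \<noteq> 0 \<and> q v = w}" "(1 - c v) * p v \<noteq> 0"
    by (rule sum.not_neutral_contains_not_neutral)
  then show ?thesis using that(2)[of v] by auto
qed (use that in blast)

lemma push_id:
  assumes \<sigma>: "finite \<sigma>" "p \<in> face \<sigma>" and c: "\<And>v. p v \<noteq> 0 \<Longrightarrow> c v = 1 \<or> q v = v"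
  shows "push q c p = p"
proof
  fix w
  \<comment> \<open>The two ranges differ only in vertices with \<open>q v \<noteq> v\<close>; there
    \<open>p v = 0\<close> or \<open>c v = 1\<close>, so the term vanishes.\<close>
  have "(\<Sum>v | v \<in> \<sigma> \<and> q v = w. (1 - c v) * p v) = (\<Sum>v | v \<in> \<sigma> \<and> v = w. (1 - c v) * p v)"
    using \<sigma>(1) c by (intro sum.mono_neutral_cong) (auto, metis+)
  also have "{v. v \<in> \<sigma> \<and> v = w} = (if w \<in> \<sigma> then {w} else {})" by auto
  finally show "push q c p w = p w"
    using \<sigma>(2) by (auto simp: push_face[OF \<sigma>] face_def algebra_simps)
qed

lemma push_homotopic:
  assumes K: "abstract_complex K"
    and cont: "\<And>\<sigma> v. \<sigma> \<in> K \<Longrightarrow> continuous_on (face \<sigma>) (\<lambda>p. c p v)"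
    and c: "\<And>p v. p \<in> topspace (realization K) \<Longrightarrow> 0 \<le> c p v \<and> c p v \<le> 1"
    and carr: "\<And>\<sigma>. \<sigma> \<in> K \<Longrightarrow> \<sigma> \<union> q ` \<sigma> \<in> K \<or> (\<forall>p\<in>face \<sigma>. push q (c p) p = p)"
    and fixed: "\<And>x. x \<in> T \<Longrightarrow> push q (c x) x = x"
  shows "homotopic_with (\<lambda>g. \<forall>x\<in>T. g x = x) (realization K) (realization K) id (\<lambda>p. push q (c p) p)"
proof (rule straight_line_homotopy[OF K])
  fix \<sigma> assume \<sigma>: "\<sigma> \<in> K"
  then have fin: "finite \<sigma>" by (rule abstract_complexD[OF K])
  have "continuous_on (face \<sigma>) (\<lambda>p w. c p w * p w + (\<Sum>v | v \<in> \<sigma> \<and> q v = w. (1 - c p v) * p v))"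
    by (intro continuous_on_coordinatewise_then_product continuous_intros cont[OF \<sigma>]
        continuous_on_coordinate)
  then show "continuous_on (face \<sigma>) (\<lambda>p. push q (c p) p)"
    by (rule continuous_on_eq) (simp add: push_face[OF fin] fun_eq_iff)
  show "\<exists>\<tau>\<in>K. \<sigma> \<subseteq> \<tau> \<and> (\<lambda>p. push q (c p) p) ` face \<sigma> \<subseteq> face \<tau>"
    using carr[OF \<sigma>]
  proof
    assume *: "\<sigma> \<union> q ` \<sigma> \<in> K"
    have "push q (c p) p \<in> face (\<sigma> \<union> q ` \<sigma>)" if "p \<in> face \<sigma>" for p
      using fin that c \<sigma> by (intro push_in_face) (auto simp: topspace_realization)
    with * show ?thesis by blast
  next
    assume "\<forall>p\<in>face \<sigma>. push q (c p) p = p"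
    then have "(\<lambda>p. push q (c p) p) ` face \<sigma> \<subseteq> face \<sigma>" by auto
    with \<sigma> show ?thesis by blast
  qed
qed (rule fixed)

section \<open>Deformations\<close>

text \<open>The target \<open>S\<close> and the set \<open>T\<close> fixed throughout are kept apart
  because the first half of a step ends in a complex larger than the one it fixes. For
  \<open>S = T\<close>, a subset of the space, this is a strong deformation retraction.\<close>

definition deforms :: "'a topology \<Rightarrow> 'a set \<Rightarrow> 'a set \<Rightarrow> bool" where
  "deforms X S T \<longleftrightarrow>
     (\<exists>r. homotopic_with (\<lambda>g. \<forall>x\<in>T. g x = x) X X id r \<and> r ` topspace X \<subseteq> S)"

lemma deforms_trans:
  assumes "deforms X S T" "deforms (subtopology X S) S' T"
  shows "deforms X S' T"
proof -
  obtain r1 where r1: "homotopic_with (\<lambda>g. \<forall>x\<in>T. g x = x) X X id r1" "r1 ` topspace X \<subseteq> S"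
    using assms(1) by (auto simp: deforms_def)
  obtain r2 where r2: "homotopic_with (\<lambda>g. \<forall>x\<in>T. g x = x) (subtopology X S) (subtopology X S) id r2"
      "r2 ` topspace (subtopology X S) \<subseteq> S'"
    using assms(2) by (auto simp: deforms_def)
  have c1: "continuous_map X X r1" using homotopic_with_imp_continuous_maps[OF r1(1)] by simp
  then have "continuous_map X (subtopology X S) r1"
    using r1(2) by (simp add: continuous_map_in_subtopology image_subset_iff_funcset)
  moreover have f1: "\<forall>x\<in>T. r1 x = x" using homotopic_with_imp_property[OF r1(1)] by simp
  ultimately have "homotopic_with (\<lambda>g. \<forall>x\<in>T. g x = x) X (subtopology X S) (id \<circ> r1) (r2 \<circ> r1)"
    by (intro homotopic_with_compose_continuous_map_right[OF r2(1)]) auto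
  then have "homotopic_with (\<lambda>g. \<forall>x\<in>T. g x = x) X X (id \<circ> (id \<circ> r1)) (id \<circ> (r2 \<circ> r1))"
    by (rule homotopic_with_compose_continuous_map_left)
       (auto intro: continuous_map_from_subtopology continuous_map_id)
  then have "homotopic_with (\<lambda>g. \<forall>x\<in>T. g x = x) X X id (r2 \<circ> r1)"
    using homotopic_with_trans[OF r1(1)] by simp
  moreover have "(r2 \<circ> r1) ` topspace X \<subseteq> S'"
    using r1(2) r2(2) continuous_map_image_subset_topspace[OF c1] by fastforce
  ultimately show ?thesis unfolding deforms_def by blast
qed

lemma continuous_map_realization_mono:
  assumes "L \<subseteq> K"
  shows "continuous_map (realization L) (realization K) id"
  using assms by (intro continuous_map_realization continuous_map_face_realization) blast

text \<open>Being stationary on \<open>M\<close>, where alone distinct \<open>L i\<close> can meet,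
  the given homotopies agree on overlaps. Each simplex lies in \<open>M\<close> or in some
  \<open>L i\<close>, so the combined map is continuous however large \<open>I\<close> is.\<close>

lemma deforms_glue:
  assumes K: "K = M \<union> (\<Union>i\<in>I. L i)"
    and L: "\<And>i. i \<in> I \<Longrightarrow> abstract_complex (L i)" "\<And>i. i \<in> I \<Longrightarrow> M \<subseteq> L i"
    and Int: "\<And>i j. i \<in> I \<Longrightarrow> j \<in> I \<Longrightarrow> i \<noteq> j \<Longrightarrow> L i \<inter> L j \<subseteq> M"
    and def: "\<And>i. i \<in> I \<Longrightarrow> deforms (realization (L i)) (\<Union>\<sigma>\<in>M. face \<sigma>) (\<Union>\<sigma>\<in>M. face \<sigma>)"
  shows "deforms (realization K) (\<Union>\<sigma>\<in>M. face \<sigma>) (\<Union>\<sigma>\<in>M. face \<sigma>)"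
proof -
  let ?M = "\<Union>\<sigma>\<in>M. face \<sigma>" and ?I = "top_of_set {0..1::real}"
  define H where "H i h \<longleftrightarrow>
      continuous_map (prod_topology ?I (realization (L i))) (realization (L i)) h \<and>
      (\<forall>x. h (0, x) = x) \<and> (\<forall>x\<in>topspace (realization (L i)). h (1, x) \<in> ?M) \<and>
      (\<forall>t\<in>{0..1}. \<forall>x\<in>?M. h (t, x) = x)" for i h
  have "\<forall>i\<in>I. \<exists>h. H i h"
  proof
    fix i assume "i \<in> I"
    from def[OF this] obtain r h where r: "r ` topspace (realization (L i)) \<subseteq> ?M"
      and h: "continuous_map (prod_topology ?I (realization (L i))) (realization (L i)) h"
        "\<forall>x. h (0, x) = id x" "\<forall>x. h (1, x) = r x" "\<forall>t\<in>{0..1}. \<forall>x\<in>?M. h (t, x) = x"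
      unfolding deforms_def homotopic_with_def by blast
    have "\<forall>x\<in>topspace (realization (L i)). h (1, x) \<in> ?M"
      using r h(3) by (metis image_subset_iff)
    with h have "H i h" unfolding H_def id_apply by blast
    then show "\<exists>h. H i h" by blast
  qed
  then obtain h where "\<forall>i\<in>I. H i (h i)" by (rule bchoice[THEN exE])
  then have H: "H i (h i)" if "i \<in> I" for i using that by (rule bspec)
  have h: "continuous_map (prod_topology ?I (realization (L i))) (realization (L i)) (h i)"
    and h0: "h i (0, x) = x"
    and h1: "x \<in> topspace (realization (L i)) \<Longrightarrow> h i (1, x) \<in> ?M"
    and hM: "t \<in> {0..1} \<Longrightarrow> x \<in> ?M \<Longrightarrow> h i (t, x) = x" if "i \<in> I" for i t x
    using H[OF that] unfolding H_def by blast+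
  define idx where "idx x = (SOME i. i \<in> I \<and> x \<in> topspace (realization (L i)))" for x
  \<comment> \<open>Outside the space \<open>g\<close> is the identity, because
    \<open>homotopic_with\<close> prescribes the initial map at all arguments.\<close>
  define g where "g y = (if snd y \<in> ?M \<or> snd y \<notin> topspace (realization K) then snd y
     else h (idx (snd y)) y)" for y
  \<comment> \<open>If \<open>x\<close> lay in two of the complexes, the intersection of its two
    carrying simplices would carry \<open>x\<close> and belong to both, hence to
    \<open>M\<close>.\<close>
  have idx: "idx x = i" if x_i: "i \<in> I" "x \<in> topspace (realization (L i))" "x \<notin> ?M" for i x
    unfolding idx_def
  proof (rule some_equality)
    fix j assume j: "j \<in> I \<and> x \<in> topspace (realization (L j))"
    show "j = i"
    proof (rule ccontr)
      assume "j \<noteq> i"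
      obtain \<sigma> \<tau> where *: "\<sigma> \<in> L i" "\<tau> \<in> L j" "x \<in> face \<sigma>" "x \<in> face \<tau>"
        using x_i(2) j unfolding topspace_realization by blast
      have "finite \<sigma>" "finite \<tau>"
        using * abstract_complexD(1)[OF L(1)] x_i(1) j by blast+
      then have x: "x \<in> face (\<sigma> \<inter> \<tau>)" using * face_Int by blast
      then have ne: "\<sigma> \<inter> \<tau> \<noteq> {}" using face_nonempty_support by fastforce
      have "\<sigma> \<inter> \<tau> \<in> L i" "\<sigma> \<inter> \<tau> \<in> L j"
        using abstract_complexD(3)[OF L(1) *(1)] abstract_complexD(3)[OF L(1) *(2)] x_i(1) j ne
        by blast+
      then have "\<sigma> \<inter> \<tau> \<in> M" using Int[of i j] x_i(1) j \<open>j \<noteq> i\<close> by blast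
      with x x_i(3) show False by blast
    qed
  qed (use x_i in blast)
  have "continuous_map (prod_topology ?I (realization K)) (realization K) g"
  proof (rule continuous_map_prod_realization)
    show "locally_compact_space ?I"
      by (simp add: compact_imp_locally_compact_space compact_space_subtopology)
    show "Hausdorff_space ?I" by (simp add: Hausdorff_space_subtopology)
    fix \<sigma> assume \<sigma>: "\<sigma> \<in> K"
    show "continuous_map (prod_topology ?I (top_of_set (face \<sigma>))) (realization K) g"
    proof (cases "\<sigma> \<in> M")
      case True
      have "continuous_map (prod_topology ?I (top_of_set (face \<sigma>))) (realization K) (id \<circ> snd)"
        by (rule continuous_map_compose[OF continuous_map_snd continuous_map_face_realization[OF \<sigma>]])
      then show ?thesis
        by (rule continuous_map_eq) (use True in \<open>auto simp: g_def\<close>)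
    next
      case False
      then obtain i where i: "i \<in> I" "\<sigma> \<in> L i" using \<sigma> K by blast
      have "continuous_map (prod_topology ?I (top_of_set (face \<sigma>)))
          (prod_topology ?I (realization (L i))) (\<lambda>y. (fst y, id (snd y)))"
        by (intro continuous_map_pairedI continuous_map_fst
            continuous_map_compose[OF continuous_map_snd continuous_map_face_realization[OF i(2)],
              unfolded o_def])
      then have "continuous_map (prod_topology ?I (top_of_set (face \<sigma>))) (realization (L i))
          (h i \<circ> (\<lambda>y. (fst y, id (snd y))))"
        by (rule continuous_map_compose) (rule h[OF i(1)])
      moreover have "L i \<subseteq> K" using K i(1) by blast
      ultimately have "continuous_map (prod_topology ?I (top_of_set (face \<sigma>))) (realization K)
          (id \<circ> (h i \<circ> (\<lambda>y. (fst y, id (snd y)))))"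
        using continuous_map_compose continuous_map_realization_mono by blast
      then show ?thesis
      proof (rule continuous_map_eq)
        fix y assume "y \<in> topspace (prod_topology ?I (top_of_set (face \<sigma>)))"
        then obtain t x where y: "y = (t, x)" "t \<in> {0..1}" "x \<in> face \<sigma>" by auto
        then have x: "x \<in> topspace (realization (L i))" "x \<in> topspace (realization K)"
          using i(2) \<sigma> unfolding topspace_realization by blast+
        show "(id \<circ> (h i \<circ> (\<lambda>y. (fst y, id (snd y))))) y = g y"
          using hM[OF i(1) y(2)] idx[OF i(1) x(1)] x(2) y(1) by (auto simp: g_def)
      qed
    qed
  qed
  moreover have "\<exists>i\<in>I. x \<in> topspace (realization (L i)) \<and> idx x = i"
    if "x \<notin> ?M" "x \<in> topspace (realization K)" for x
    using that idx[of _ x] unfolding topspace_realization K by blast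
  ultimately show ?thesis
    unfolding deforms_def homotopic_with_def
  proof (intro exI[of _ "\<lambda>x. g (1, x)"] conjI exI[of _ g] ballI allI)
    assume *: "\<And>x. x \<notin> ?M \<Longrightarrow> x \<in> topspace (realization K) \<Longrightarrow>
        \<exists>i\<in>I. x \<in> topspace (realization (L i)) \<and> idx x = i"
    show "g (0, x) = id x" for x
    proof (cases "x \<in> ?M \<or> x \<notin> topspace (realization K)")
      case False
      with *[of x] have "idx x \<in> I" by blast
      with False show ?thesis by (simp add: g_def h0)
    qed (simp only: g_def snd_conv if_True id_apply)
    show "(\<lambda>x. g (1, x)) ` topspace (realization K) \<subseteq> ?M"
    proof (rule image_subsetI)
      fix x assume x: "x \<in> topspace (realization K)"
      show "g (1, x) \<in> ?M"
      proof (cases "x \<in> ?M")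
        case False
        with *[of x] x have "idx x \<in> I" "x \<in> topspace (realization (L (idx x)))" by blast+
        moreover have "g (1, x) = h (idx x) (1, x)" using False x by (simp add: g_def)
        ultimately show ?thesis using h1 by simp
      qed (simp only: g_def snd_conv if_True simp_thms)
    qed
    show "g (t, x) = x" if "x \<in> ?M" for t x
      using that by (simp only: g_def snd_conv if_True simp_thms)
  qed (assumption, rule refl)
qed

section \<open>Deforming one attached piece, then all pieces at once\<close>

lemma continuous_map_mass:
  assumes "abstract_complex K"
  shows "continuous_map (realization K) euclideanreal (mass Y)"
  using assms by (intro continuous_map_realization)
    (auto intro: continuous_on_mass abstract_complexD(1))

lemma topspace_realization_Diff:
  assumes K: "abstract_complex K" and x: "x \<in> topspace (realization K)"
    and S: "\<And>v. x v \<noteq> 0 \<Longrightarrow> v \<in> S"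
  shows "x \<in> (\<Union>\<sigma>\<in>{\<sigma>\<in>K. \<sigma> \<subseteq> S}. face \<sigma>)"
proof -
  obtain \<sigma> where \<sigma>: "\<sigma> \<in> K" "x \<in> face \<sigma>" using x unfolding topspace_realization by blast
  have fin: "finite \<sigma>" by (rule abstract_complexD(1)[OF K \<sigma>(1)])
  have x': "x \<in> face (\<sigma> \<inter> S)"
    by (rule face_support[OF fin \<sigma>(2)]) (use S fin in blast)+
  then have "\<sigma> \<inter> S \<noteq> {}" using face_nonempty_support by fastforce
  then have "\<sigma> \<inter> S \<in> K" by (intro abstract_complexD(3)[OF K \<sigma>(1)]) auto
  with x' show ?thesis by blast
qed

text \<open>
  A contraction of the piece spanned by \<open>Y\<close> and \<open>a\<close> need not fix the vertex \<open>a\<close>. So the mass outside \<open>Y \<union> {a}\<close>, and then the mass in \<open>Y\<close>, is first pushed into \<open>a\<close> on a collar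
  \<open>1/3 \<le> mass Y \<le> 2/3\<close>, where the contraction \<open>H\<close> can be faded in; afterwards the track of \<open>a\<close>
  under \<open>H\<close> is run backwards.
\<close>

lemma deforms_piece:
  fixes K :: "'v set set"
  assumes K: "abstract_complex K"
    and a: "a \<notin> Y" "{a} \<in> K"
    and ins: "\<And>\<sigma>. \<sigma> \<in> K \<Longrightarrow> \<sigma> \<inter> Y \<noteq> {} \<Longrightarrow> \<not> \<sigma> \<subseteq> Y \<Longrightarrow> insert a \<sigma> \<in> K"
    and contr: "contractible_space (realization {\<sigma>\<in>K. \<sigma> \<subseteq> insert a Y})"
  defines "M \<equiv> \<Union>\<sigma>\<in>{\<sigma>\<in>K. \<sigma> \<inter> Y = {}}. face \<sigma>"
  shows "deforms (realization K) M M"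
proof -
  let ?I = "top_of_set {0..1::real}" and ?X = "realization K"
  define N where "N = {\<sigma>\<in>K. \<sigma> \<subseteq> insert a Y}"
  define e where "e = (\<lambda>w. if w = a then 1 else 0 :: real)"
  have N: "abstract_complex N" "N \<subseteq> K"
    using K unfolding N_def abstract_complex_def by blast+
  have sub_N: "subtopology ?X (\<Union>\<sigma>\<in>N. face \<sigma>) = realization N"
    by (rule subtopology_realization[OF K N])
  have "\<exists>x0. homotopic_with (\<lambda>x. True) (realization N) (realization N) id (\<lambda>x. x0)"
    using contr by (simp add: contractible_space_def N_def)
  then obtain x0 H where H: "continuous_map (prod_topology ?I (realization N)) (realization N) H"
    and H0: "\<And>x. H (0, x) = x" and H1: "\<And>x. H (1, x) = x0"
    unfolding homotopic_with_def id_apply by blast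
  define m where "m = mass Y"
  \<comment> \<open>With m the mass in \<open>Y\<close>: vertices of \<open>Y\<close> keep nothing
    up to m = 2/3, the others keep nothing from m = 1/3 on, so on the collar everything sits at
    \<open>a\<close>. At m = 0 the vertices outside \<open>Y\<close> keep all, so \<open>M\<close>
    is fixed; at m = 1 those of \<open>Y\<close> keep all, so simplices inside \<open>Y\<close>, to
    which \<open>a\<close> perhaps cannot be adjoined, do not move.\<close>
  define c where "c x v = (if v \<in> Y then max 0 (3 * m x - 2) else 1 - min 1 (3 * m x))" for x v
  define \<rho> where "\<rho> x = push (\<lambda>_. a) (c x) x" for x
  have fin: "finite \<sigma>" if "\<sigma> \<in> K" for \<sigma> by (rule abstract_complexD(1)[OF K that])
  have X: "\<exists>\<sigma>\<in>K. x \<in> face \<sigma>" if "x \<in> topspace ?X" for x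
    using that unfolding topspace_realization by blast
  have m01: "0 \<le> m x" "m x \<le> 1" if "x \<in> topspace ?X" for x
    using X[OF that] mass_nonneg mass_le_1 fin unfolding m_def by blast+
  have m_cont: "continuous_map ?X euclideanreal m"
    unfolding m_def by (rule continuous_map_mass[OF K])
  have M_sub: "M \<subseteq> topspace ?X" unfolding M_def topspace_realization by blast
  have m_M: "m x = 0" if x: "x \<in> M" for x
  proof -
    obtain \<sigma> where \<sigma>: "\<sigma> \<in> K" "\<sigma> \<inter> Y = {}" "x \<in> face \<sigma>" using x unfolding M_def by blast
    then have "\<forall>v\<in>Y. x v = 0" by (auto simp: face_def)
    with mass_eq_0_iff[OF fin[OF \<sigma>(1)] \<sigma>(3)] show ?thesis unfolding m_def by blast
  qed
  have in_M: "x \<in> M" if "x \<in> topspace ?X" "\<And>v. x v \<noteq> 0 \<Longrightarrow> v \<in> - Y" for x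
  proof -
    have "{\<sigma>\<in>K. \<sigma> \<inter> Y = {}} = {\<sigma>\<in>K. \<sigma> \<subseteq> - Y}" by blast
    with topspace_realization_Diff[OF K that] show ?thesis unfolding M_def by simp
  qed
  have \<rho>_M: "\<rho> x = x" if x: "x \<in> M" for x
  proof -
    obtain \<sigma> where \<sigma>: "\<sigma> \<in> K" "\<sigma> \<inter> Y = {}" "x \<in> face \<sigma>" using x unfolding M_def by blast
    show ?thesis unfolding \<rho>_def
    proof (rule push_id[OF fin[OF \<sigma>(1)] \<sigma>(3)])
      fix v assume "x v \<noteq> 0"
      then have "v \<notin> Y" using \<sigma> by (auto simp: face_def)
      then show "c x v = 1 \<or> a = v" by (simp add: c_def m_M[OF x])
    qed
  qed
  have \<rho>_hom: "homotopic_with (\<lambda>g. \<forall>x\<in>M. g x = x) ?X ?X id \<rho>"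
    unfolding \<rho>_def
  proof (rule push_homotopic[OF K])
    fix \<sigma> v assume \<sigma>: "\<sigma> \<in> K"
    have "continuous_on (face \<sigma>) m" unfolding m_def by (rule continuous_on_mass[OF fin[OF \<sigma>]])
    then show "continuous_on (face \<sigma>) (\<lambda>p. c p v)"
      by (cases "v \<in> Y") (simp_all add: c_def continuous_on_max continuous_on_min
          continuous_on_diff continuous_on_mult)
  next
    fix x v assume "x \<in> topspace ?X"
    from m01[OF this] show "0 \<le> c x v \<and> c x v \<le> 1" unfolding c_def by auto
  next
    fix \<sigma> assume \<sigma>: "\<sigma> \<in> K"
    consider "\<sigma> \<inter> Y = {}" | "\<sigma> \<subseteq> Y" | "\<sigma> \<inter> Y \<noteq> {}" "\<not> \<sigma> \<subseteq> Y" by blast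
    then show "\<sigma> \<union> (\<lambda>_. a) ` \<sigma> \<in> K \<or> (\<forall>p\<in>face \<sigma>. push (\<lambda>_. a) (c p) p = p)"
    proof cases
      case 1
      then have "face \<sigma> \<subseteq> M" using \<sigma> unfolding M_def by blast
      then show ?thesis using \<rho>_M unfolding \<rho>_def by blast
    next
      case 2
      have "push (\<lambda>_. a) (c p) p = p" if p: "p \<in> face \<sigma>" for p
      proof (rule push_id[OF fin[OF \<sigma>] p])
        have Y: "v \<in> Y" if "p v \<noteq> 0" for v using p 2 that by (auto simp: face_def)
        have "m p = 1" unfolding m_def by (rule mass_eq_1[OF fin[OF \<sigma>] p Y])
        then show "c p v = 1 \<or> a = v" if "p v \<noteq> 0" for v using Y[OF that] by (simp add: c_def)
      qed
      then show ?thesis by blast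
    next
      case 3
      then have "\<sigma> \<union> (\<lambda>_. a) ` \<sigma> = insert a \<sigma>" by auto
      then show ?thesis using ins[OF \<sigma> 3] by simp
    qed
  next
    fix x assume "x \<in> M"
    then show "push (\<lambda>_. a) (c x) x = x" using \<rho>_M unfolding \<rho>_def by blast
  qed
  then have \<rho>_cont: "continuous_map ?X ?X \<rho>"
    using homotopic_with_imp_continuous_maps by blast
  have \<rho>_X: "\<rho> x \<in> topspace ?X" if "x \<in> topspace ?X" for x
    using continuous_map_image_subset_topspace[OF \<rho>_cont] that by blast
  have supp: "(c x w \<noteq> 0 \<and> x w \<noteq> 0) \<or> w = a" if "\<rho> x w \<noteq> 0" for x w
    using that unfolding \<rho>_def by (rule push_support) auto
  have low: "\<rho> x w \<noteq> 0 \<Longrightarrow> w \<in> - Y" if "m x \<le> 2/3" for x w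
    using supp[of x w] that a(1) by (auto simp: c_def split: if_splits)
  have high: "\<rho> x w \<noteq> 0 \<Longrightarrow> w \<in> insert a Y" if "1/3 \<le> m x" for x w
    using supp[of x w] that by (auto simp: c_def split: if_splits)
  have \<rho>_low: "\<rho> x \<in> M" if "x \<in> topspace ?X" "m x \<le> 1/3" for x
    using that low[of x] by (intro in_M \<rho>_X) auto
  have \<rho>_high: "\<rho> x \<in> (\<Union>\<sigma>\<in>N. face \<sigma>)" if "x \<in> topspace ?X" "1/3 \<le> m x" for x
    using topspace_realization_Diff[OF K \<rho>_X[OF that(1)] high[OF that(2)]] unfolding N_def by simp
  have \<rho>_mid: "\<rho> x = e" if x: "x \<in> topspace ?X" "1/3 \<le> m x" "m x \<le> 2/3" for x
  proof -
    obtain \<sigma> where \<sigma>: "\<sigma> \<in> K" "\<rho> x \<in> face \<sigma>" using X[OF \<rho>_X[OF x(1)]] by blast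
    have "\<rho> x w = 0" if "w \<notin> {a}" for w
      using low[OF x(3), of w] high[OF x(2), of w] that by blast
    then have "\<rho> x \<in> face {a}" by (intro face_support[OF fin[OF \<sigma>(1)] \<sigma>(2)]) auto
    then show ?thesis unfolding face_singleton e_def by blast
  qed
  have e_face: "e \<in> face {a}" unfolding face_singleton e_def by blast
  have e_N: "e \<in> (\<Union>\<sigma>\<in>N. face \<sigma>)" using e_face a unfolding N_def by blast
  have e_M: "e \<in> M" using e_face a unfolding M_def by blast
  \<comment> \<open>The common shape of the two remaining homotopies: \<open>\<rho>\<close> on the
    closed part m \<le> 1/3, and \<open>H\<close> on the closed part m \<ge> 1/3, where its argument
    lies in the domain \<open>N\<close>. On the seam \<open>H\<close> is taken at time 0, where it
    is the identity.\<close>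
  have paste: "continuous_map (prod_topology ?I ?X) ?X
      (\<lambda>y. if m (snd y) \<le> 1/3 then \<rho> (snd y) else H (u y, v y))"
    if u: "continuous_map (prod_topology ?I ?X) euclideanreal u"
        "\<And>y. y \<in> topspace (prod_topology ?I ?X) \<Longrightarrow> 0 \<le> u y \<and> u y \<le> 1"
      and v: "continuous_map (prod_topology ?I ?X) ?X v"
        "\<And>y. y \<in> topspace (prod_topology ?I ?X) \<Longrightarrow> 1/3 \<le> m (snd y) \<Longrightarrow> v y \<in> (\<Union>\<sigma>\<in>N. face \<sigma>)"
      and eq: "\<And>y. y \<in> topspace (prod_topology ?I ?X) \<Longrightarrow> m (snd y) = 1/3 \<Longrightarrow>
        u y = 0 \<and> v y = \<rho> (snd y)" for u v
  proof (rule continuous_map_cases_le)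
    show "continuous_map (prod_topology ?I ?X) euclideanreal (\<lambda>y. m (snd y))"
      using continuous_map_compose[OF continuous_map_snd m_cont] by (simp add: o_def)
    have "continuous_map (prod_topology ?I ?X) ?X (\<lambda>y. \<rho> (snd y))"
      using continuous_map_compose[OF continuous_map_snd \<rho>_cont] by (simp add: o_def)
    then show "continuous_map (subtopology (prod_topology ?I ?X)
        {y \<in> topspace (prod_topology ?I ?X). m (snd y) \<le> 1/3}) ?X (\<lambda>y. \<rho> (snd y))"
      by (rule continuous_map_from_subtopology)
    let ?S = "subtopology (prod_topology ?I ?X) {y \<in> topspace (prod_topology ?I ?X). 1/3 \<le> m (snd y)}"
    have "continuous_map ?S ?I u"
      using u continuous_map_from_subtopology[OF u(1)]
      by (auto simp: continuous_map_in_subtopology)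
    moreover have "continuous_map ?S (realization N) v"
      unfolding sub_N[symmetric]
      using v(2) continuous_map_from_subtopology[OF v(1)]
      by (auto simp: continuous_map_in_subtopology)
    ultimately have "continuous_map ?S (prod_topology ?I (realization N)) (\<lambda>y. (u y, v y))"
      by (rule continuous_map_pairedI)
    then have "continuous_map ?S (realization N) (H \<circ> (\<lambda>y. (u y, v y)))"
      using H by (rule continuous_map_compose)
    then have "continuous_map ?S ?X (H \<circ> (\<lambda>y. (u y, v y)))"
      unfolding sub_N[symmetric] by (rule continuous_map_into_fulltopology)
    then show "continuous_map ?S ?X (\<lambda>y. H (u y, v y))" by (simp add: o_def)
    show "\<rho> (snd y) = H (u y, v y)"
      if "y \<in> topspace (prod_topology ?I ?X)" "m (snd y) = 1/3" for y
      using eq[OF that] H0 by simp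
  qed simp
  \<comment> \<open>The fading factor: 0 up to m = 1/3, then linear, and 1 from m = 2/3 on.\<close>
  define s where "s x = max 0 (min 1 (3 * m x - 1))" for x
  have s01: "0 \<le> s x" "s x \<le> 1" for x unfolding s_def by auto
  have s_cont: "continuous_map (prod_topology ?I ?X) euclideanreal (\<lambda>y. s (snd y))"
    unfolding s_def using continuous_map_compose[OF continuous_map_snd m_cont]
    by (intro continuous_map_real_max continuous_map_real_min continuous_map_diff
        continuous_map_real_mult continuous_map_const[THEN iffD2]) (auto simp: o_def)
  have t_cont: "continuous_map (prod_topology ?I ?X) euclideanreal fst"
    by (rule continuous_map_into_fulltopology[OF continuous_map_fst])
  \<comment> \<open>\<open>G2\<close> applies the contraction up to time \<open>s\<close>;
    \<open>G3\<close> then runs the track of the vertex \<open>a\<close> backwards from time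
    \<open>s\<close> to 0, ending at \<open>e\<close>, which lies in \<open>M\<close>.\<close>
  define G2 where "G2 y = (if m (snd y) \<le> 1/3 then \<rho> (snd y)
    else H (fst y * s (snd y), \<rho> (snd y)))" for y
  define G3 where "G3 y = (if m (snd y) \<le> 1/3 then \<rho> (snd y)
    else H ((1 - fst y) * s (snd y), e))" for y
  have G2: "continuous_map (prod_topology ?I ?X) ?X G2"
    unfolding G2_def
  proof (rule paste)
    show "continuous_map (prod_topology ?I ?X) euclideanreal (\<lambda>y. fst y * s (snd y))"
      by (intro continuous_map_real_mult t_cont s_cont)
    show "continuous_map (prod_topology ?I ?X) ?X (\<lambda>y. \<rho> (snd y))"
      using continuous_map_compose[OF continuous_map_snd \<rho>_cont] by (simp add: o_def)
    show "\<rho> (snd y) \<in> (\<Union>\<sigma>\<in>N. face \<sigma>)"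
      if "y \<in> topspace (prod_topology ?I ?X)" "1/3 \<le> m (snd y)" for y
      using that by (intro \<rho>_high) auto
  qed (use s01 in \<open>auto simp: mult_le_one\<close>, simp add: s_def)
  have G3: "continuous_map (prod_topology ?I ?X) ?X G3"
    unfolding G3_def
  proof (rule paste)
    show "continuous_map (prod_topology ?I ?X) euclideanreal (\<lambda>y. (1 - fst y) * s (snd y))"
      by (intro continuous_map_real_mult continuous_map_diff t_cont s_cont) simp
    show "continuous_map (prod_topology ?I ?X) ?X (\<lambda>y. e)"
      using e_M M_sub by auto
    show "(1 - fst y) * s (snd y) = 0 \<and> e = \<rho> (snd y)"
      if "y \<in> topspace (prod_topology ?I ?X)" "m (snd y) = 1/3" for y
      using that \<rho>_mid[of "snd y"] by (auto simp: s_def)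
  qed (use s01 e_N in \<open>auto simp: mult_le_one\<close>)
  have fixed: "G2 (t, x) = x" "G3 (t, x) = x" if "x \<in> M" for t x
    using m_M[OF that] \<rho>_M[OF that] by (simp_all add: G2_def G3_def)
  have "homotopic_with (\<lambda>g. \<forall>x\<in>M. g x = x) ?X ?X \<rho> (\<lambda>x. G2 (1, x))"
    unfolding homotopic_with_def
    by (intro exI[of _ G2] conjI G2) (simp_all add: fixed, simp add: G2_def H0)
  moreover have "homotopic_with (\<lambda>g. \<forall>x\<in>M. g x = x) ?X ?X (\<lambda>x. G2 (1, x)) (\<lambda>x. G3 (1, x))"
  \<comment> \<open>\<open>G2\<close> and \<open>G3\<close> match only on the space itself. The
    version of the definition used here needs no more, provided the property depends only on values
    there; it does, as \<open>M\<close> lies in the space.\<close>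
  proof (subst homotopic_with, goal_cases)
    case (1 h k)
    then show ?case using M_sub by (metis subsetD)
  next
    case 2
    \<comment> \<open>On the collar \<open>\<rho> x\<close> is \<open>e\<close>, so both sides are
      the same point of the track; beyond it \<open>s x = 1\<close>, and \<open>H\<close> at time 1
      forgets its argument.\<close>
    have "G3 (0, x) = G2 (1, x)" if x: "x \<in> topspace ?X" for x
    proof (cases "m x \<le> 2/3")
      case True
      then show ?thesis using \<rho>_mid[OF x] by (auto simp: G2_def G3_def)
    next
      case False
      then have "s x = 1" by (simp add: s_def)
      with False show ?thesis by (simp add: G2_def G3_def H1)
    qed
    then show ?case
      by (intro exI[of _ G3] conjI G3) (simp_all add: fixed)
  qed
  ultimately have "homotopic_with (\<lambda>g. \<forall>x\<in>M. g x = x) ?X ?X id (\<lambda>x. G3 (1, x))"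
    using homotopic_with_trans \<rho>_hom by blast
  moreover have "(\<lambda>x. G3 (1, x)) ` topspace ?X \<subseteq> M"
    using \<rho>_low e_M by (auto simp: G3_def H0)
  ultimately show ?thesis unfolding deforms_def by blast
qed

text \<open>A simplex may meet many pieces, so \<open>deforms_piece\<close> cannot be applied to
  them simultaneously. A preliminary push empties every piece holding at most half of the mass; at
  most one piece survives at each point. The result lies in the union of the complexes
  \<open>L i\<close>, which see a single piece and overlap only in \<open>M\<close>, so the pieces
  can be deformed separately and glued.\<close>

lemma deforms_step:
  fixes K :: "'v set set" and I :: "'i set"
  assumes K: "abstract_complex K"
    and disj: "\<And>i j. i \<in> I \<Longrightarrow> j \<in> I \<Longrightarrow> i \<noteq> j \<Longrightarrow> Y i \<inter> Y j = {}"
    and b: "\<And>i j. i \<in> I \<Longrightarrow> j \<in> I \<Longrightarrow> b i \<notin> Y j" "\<And>i. i \<in> I \<Longrightarrow> {b i} \<in> K"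
    and ins: "\<And>\<sigma> i. \<sigma> \<in> K \<Longrightarrow> i \<in> I \<Longrightarrow> \<sigma> \<inter> Y i \<noteq> {} \<Longrightarrow> \<not> \<sigma> \<subseteq> Y i \<Longrightarrow> insert (b i) \<sigma> \<in> K"
    and contr: "\<And>i. i \<in> I \<Longrightarrow> contractible_space (realization {\<sigma>\<in>K. \<sigma> \<subseteq> insert (b i) (Y i)})"
  shows "deforms (realization K) (\<Union>\<sigma>\<in>{\<sigma>\<in>K. \<forall>i\<in>I. \<sigma> \<inter> Y i = {}}. face \<sigma>)
    (\<Union>\<sigma>\<in>{\<sigma>\<in>K. \<forall>i\<in>I. \<sigma> \<inter> Y i = {}}. face \<sigma>)"
proof -
  define M where "M = {\<sigma>\<in>K. \<forall>i\<in>I. \<sigma> \<inter> Y i = {}}"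
  define L where "L i = {\<sigma>\<in>K. \<forall>j\<in>I. j \<noteq> i \<longrightarrow> \<sigma> \<inter> Y j = {}}" for i
  define LL where "LL = M \<union> (\<Union>i\<in>I. L i)"
  let ?M = "\<Union>\<sigma>\<in>M. face \<sigma>" and ?X = "realization K"
  have L: "abstract_complex (L i)" for i
    using K unfolding abstract_complex_def L_def by blast
  have LL: "abstract_complex LL" "LL \<subseteq> K"
    using K unfolding abstract_complex_def LL_def L_def M_def by blast+
  define U where "U = (\<Union>i\<in>I. Y i)"
  define idx where "idx v = (SOME i. i \<in> I \<and> v \<in> Y i)" for v
  define q where "q v = (if v \<in> U then b (idx v) else v)" for v
  \<comment> \<open>This is 0 exactly when the piece of \<open>v\<close> has mass at most 1/2, a
    bound that two disjoint pieces cannot both exceed, and 1 when the piece has all the mass, so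
    that simplices inside a piece stay put. For \<open>v\<close> outside \<open>U\<close> the index
    is arbitrary, but \<open>q\<close> is the identity there.\<close>
  define c where "c x v = max 0 (2 * mass (Y (idx v)) x - 1)" for x v
  have idx: "idx v = i" if "i \<in> I" "v \<in> Y i" for v i
    unfolding idx_def using that disj by (intro some_equality) blast+
  have idx_U: "idx v \<in> I" "v \<in> Y (idx v)" if "v \<in> U" for v
    using that idx unfolding U_def by blast+
  have fin: "finite \<sigma>" if "\<sigma> \<in> K" for \<sigma> by (rule abstract_complexD(1)[OF K that])
  have X: "\<exists>\<sigma>\<in>K. x \<in> face \<sigma>" if "x \<in> topspace ?X" for x
    using that unfolding topspace_realization by blast
  have fixed: "push q (c x) x = x" if x: "x \<in> ?M" for x
  proof -
    obtain \<sigma> where \<sigma>: "\<sigma> \<in> K" "\<sigma> \<inter> U = {}" "x \<in> face \<sigma>" using x unfolding M_def U_def by blast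
    show ?thesis
    proof (rule push_id[OF fin[OF \<sigma>(1)] \<sigma>(3)])
      fix v assume "x v \<noteq> 0"
      then have "v \<in> \<sigma>" using \<sigma>(3) by (auto simp: face_def)
      then show "c x v = 1 \<or> q v = v" using \<sigma>(2) unfolding q_def by auto
    qed
  qed
  have hom: "homotopic_with (\<lambda>g. \<forall>x\<in>?M. g x = x) ?X ?X id (\<lambda>x. push q (c x) x)"
  proof (rule push_homotopic[OF K _ _ _ fixed])
    fix \<sigma> v assume \<sigma>: "\<sigma> \<in> K"
    show "continuous_on (face \<sigma>) (\<lambda>x. c x v)"
      unfolding c_def by (intro continuous_intros continuous_on_mass fin \<sigma>)
  next
    fix x v assume "x \<in> topspace ?X"
    then have "mass (Y (idx v)) x \<le> 1" using X mass_le_1 fin by blast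
    then show "0 \<le> c x v \<and> c x v \<le> 1" unfolding c_def by simp
  next
    fix \<sigma> assume \<sigma>: "\<sigma> \<in> K"
    show "\<sigma> \<union> q ` \<sigma> \<in> K \<or> (\<forall>x\<in>face \<sigma>. push q (c x) x = x)"
    proof (cases "\<exists>i\<in>I. \<sigma> \<subseteq> Y i")
      case True
      then obtain i where i: "i \<in> I" "\<sigma> \<subseteq> Y i" by blast
      have "push q (c x) x = x" if x: "x \<in> face \<sigma>" for x
      proof (rule push_id[OF fin[OF \<sigma>] x])
        have Y: "v \<in> Y i" if "x v \<noteq> 0" for v using x i that by (auto simp: face_def)
        have "mass (Y i) x = 1" by (rule mass_eq_1[OF fin[OF \<sigma>] x Y])
        then show "c x v = 1 \<or> q v = v" if "x v \<noteq> 0" for v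
          using idx[OF i(1) Y[OF that]] by (simp add: c_def)
      qed
      then show ?thesis by blast
    next
      case False
      \<comment> \<open>Base points are adjoined one at a time. The enlarged simplex contains
        \<sigma>, so it still meets the next piece and is still not contained in it, and
        \<open>ins\<close> applies again.\<close>
      have ind: "\<sigma> \<union> b ` J \<in> K" if "finite J" "J \<subseteq> {i\<in>I. \<sigma> \<inter> Y i \<noteq> {}}" for J
        using that
      proof (induction J)
        case (insert j J)
        then have "\<sigma> \<union> b ` J \<in> K" by blast
        from ins[OF this, of j] insert.prems False have "insert (b j) (\<sigma> \<union> b ` J) \<in> K" by blast
        then show ?case by simp
      qed (simp add: \<sigma>)
      have "\<sigma> \<union> q ` \<sigma> = \<sigma> \<union> b ` (idx ` (\<sigma> \<inter> U))" by (auto simp: q_def)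
      moreover have "idx ` (\<sigma> \<inter> U) \<subseteq> {i\<in>I. \<sigma> \<inter> Y i \<noteq> {}}" using idx_U by blast
      ultimately show ?thesis using ind fin[OF \<sigma>] by simp
    qed
  qed
  then have cont: "continuous_map ?X ?X (\<lambda>x. push q (c x) x)"
    using homotopic_with_imp_continuous_maps by blast
  have "push q (c x) x \<in> (\<Union>\<sigma>\<in>LL. face \<sigma>)" if x: "x \<in> topspace ?X" for x
  proof -
    let ?y = "push q (c x) x"
    obtain \<sigma> where \<sigma>: "\<sigma> \<in> K" "x \<in> face \<sigma>" using X[OF x] by blast
    have y: "?y \<in> topspace ?X"
      using continuous_map_image_subset_topspace[OF cont] x by blast
    \<comment> \<open>Weight found in a piece after the push was kept there, since the receivers are
      base points or vertices outside \<open>U\<close>, none of which lies in a piece.\<close>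
    have half: "mass (Y i) x > 1/2" if "i \<in> I" "w \<in> Y i" "?y w \<noteq> 0" for i w
      using that(3)
    proof (rule push_support)
      assume "c x w \<noteq> 0"
      then show ?thesis using idx[OF that(1,2)] by (simp add: c_def max_def split: if_splits)
    next
      fix v assume "q v = w"
      then have False
        using b(1) idx_U[of v] that(1,2) unfolding q_def by (cases "v \<in> U") (auto simp: U_def)
      then show ?thesis ..
    qed
    have uniq: "i = j" if "i \<in> I" "j \<in> I" "mass (Y i) x > 1/2" "mass (Y j) x > 1/2" for i j
      using mass_Un_le_1[OF fin[OF \<sigma>(1)] \<sigma>(2) disj[OF that(1,2)]] that(3,4) by fastforce
    show ?thesis
    proof (cases "\<exists>i\<in>I. \<exists>w\<in>Y i. ?y w \<noteq> 0")
      case True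
      then obtain i w where i: "i \<in> I" "w \<in> Y i" "?y w \<noteq> 0" by blast
      have "v \<in> - (\<Union>j\<in>I - {i}. Y j)" if "?y v \<noteq> 0" for v
        using half[OF i] half[of _ v] uniq i(1) that by blast
      from topspace_realization_Diff[OF K y this] show ?thesis
        using i(1) unfolding LL_def L_def by blast
    next
      case False
      then have "v \<in> - U" if "?y v \<noteq> 0" for v using that unfolding U_def by blast
      from topspace_realization_Diff[OF K y this] show ?thesis
        unfolding LL_def M_def U_def by blast
    qed
  qed
  then have "deforms ?X (\<Union>\<sigma>\<in>LL. face \<sigma>) ?M"
    unfolding deforms_def using hom by blast
  moreover have "deforms (realization LL) ?M ?M"
  proof (rule deforms_glue[OF LL_def])
    fix i assume i: "i \<in> I"
    show "abstract_complex (L i)" by (rule L)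
    show "M \<subseteq> L i" unfolding M_def L_def by blast
    have M: "{\<sigma>\<in>L i. \<sigma> \<inter> Y i = {}} = M"
    proof (rule Set.set_eqI)
      show "\<sigma> \<in> {\<sigma>\<in>L i. \<sigma> \<inter> Y i = {}} \<longleftrightarrow> \<sigma> \<in> M" for \<sigma>
        unfolding M_def L_def mem_Collect_eq using i by metis
    qed
    have N: "{\<sigma>\<in>L i. \<sigma> \<subseteq> insert (b i) (Y i)} = {\<sigma>\<in>K. \<sigma> \<subseteq> insert (b i) (Y i)}"
    proof (rule Set.set_eqI)
      have "\<sigma> \<inter> Y j = {}" if "\<sigma> \<subseteq> insert (b i) (Y i)" "j \<in> I" "j \<noteq> i" for \<sigma> j
        using that disj[OF i that(2)] b(1)[OF i that(2)] by blast
      then show "\<sigma> \<in> {\<sigma>\<in>L i. \<sigma> \<subseteq> insert (b i) (Y i)} \<longleftrightarrow>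
          \<sigma> \<in> {\<sigma>\<in>K. \<sigma> \<subseteq> insert (b i) (Y i)}" for \<sigma>
        unfolding L_def mem_Collect_eq by metis
    qed
    have bi: "{b i} \<in> L i" using b(2)[OF i] b(1)[OF i] unfolding L_def by simp
    have "insert (b i) \<sigma> \<in> L i" if "\<sigma> \<in> L i" "\<sigma> \<inter> Y i \<noteq> {}" "\<not> \<sigma> \<subseteq> Y i" for \<sigma>
      using that ins[of \<sigma> i] i b(1)[OF i] unfolding L_def mem_Collect_eq by simp
    from deforms_piece[OF L b(1)[OF i i] bi this] contr[OF i]
    show "deforms (realization (L i)) ?M ?M" unfolding M N by blast
  next
    fix i j assume "i \<in> I" "j \<in> I" "i \<noteq> j"
    then have "k \<noteq> i \<or> k \<noteq> j" for k by blast
    then show "L i \<inter> L j \<subseteq> M" unfolding L_def M_def by fast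
  qed
  ultimately have "deforms ?X ?M ?M"
    using deforms_trans subtopology_realization[OF K LL] by metis
  then show ?thesis unfolding M_def .
qed

section \<open>Attaching pieces to a Rips complex\<close>

lemma diam_le_iff:
  assumes "finite \<sigma>" "\<sigma> \<noteq> {}"
  shows "diam d \<sigma> \<le> r \<longleftrightarrow> (\<forall>x\<in>\<sigma>. \<forall>y\<in>\<sigma>. d x y \<le> r)"
  unfolding diam_def using assms by (subst cSUP_le_iff) (auto intro!: bdd_above_finite)

lemma rips_iff:
  "\<sigma> \<in> rips X d r \<longleftrightarrow> \<sigma> \<noteq> {} \<and> finite \<sigma> \<and> \<sigma> \<subseteq> X \<and> (\<forall>x\<in>\<sigma>. \<forall>y\<in>\<sigma>. d x y \<le> r)"
  unfolding rips_def using diam_le_iff[of \<sigma> d r] by (simp add: conj_ac) blast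

lemma abstract_complex_rips: "abstract_complex (rips X d r)"
  unfolding abstract_complex_def
proof (intro ballI conjI allI impI)
  fix \<sigma> \<tau> assume "\<sigma> \<in> rips X d r" "\<tau> \<subseteq> \<sigma>" "\<tau> \<noteq> {}"
  then show "\<tau> \<in> rips X d r"
    unfolding rips_iff using finite_subset[of \<tau> \<sigma>] by (simp add: subset_iff)
qed (simp_all add: rips_iff)

lemma rips_restrict: "Y \<subseteq> X \<Longrightarrow> {\<sigma> \<in> rips X d r. \<sigma> \<subseteq> Y} = rips Y d r"
  by (rule Set.set_eqI) (auto simp: rips_iff)

lemma rips_mono: "X \<subseteq> Y \<Longrightarrow> rips X d r \<subseteq> rips Y d r"
  by (rule subsetI) (auto simp: rips_iff)

text \<open>The hypothesis \<open>add\<close> says that geodesics leaving a piece pass through its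
  base point. It yields the insertion property of \<open>deforms_step\<close>: if a simplex has
  vertices on both sides, the distance from the base point to any vertex is at most the distance
  from that vertex to one on the other side, hence at most \<open>r\<close>.\<close>

lemma deforms_rips:
  fixes d :: "'v \<Rightarrow> 'v \<Rightarrow> real"
  assumes d: "\<And>x y. x \<in> X \<Longrightarrow> y \<in> X \<Longrightarrow> d x y = d y x" "\<And>x y. x \<in> X \<Longrightarrow> y \<in> X \<Longrightarrow> 0 \<le> d x y"
      "\<And>x. x \<in> X \<Longrightarrow> d x x = 0" and r: "0 \<le> r"
    and X: "X = Z \<union> (\<Union>i\<in>I. Y i)"
    and disj: "\<And>i j. i \<in> I \<Longrightarrow> j \<in> I \<Longrightarrow> i \<noteq> j \<Longrightarrow> Y i \<inter> Y j = {}"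
      "\<And>i. i \<in> I \<Longrightarrow> Z \<inter> Y i = {}"
    and b: "\<And>i. i \<in> I \<Longrightarrow> b i \<in> Z"
    and add: "\<And>i y z. i \<in> I \<Longrightarrow> y \<in> Y i \<Longrightarrow> z \<in> X - Y i \<Longrightarrow> d y z = d y (b i) + d (b i) z"
    and contr: "\<And>i. i \<in> I \<Longrightarrow> contractible_space (realization (rips (insert (b i) (Y i)) d r))"
  shows "deforms (realization (rips X d r)) (\<Union>\<sigma>\<in>rips Z d r. face \<sigma>) (\<Union>\<sigma>\<in>rips Z d r. face \<sigma>)"
proof -
  have "{\<sigma> \<in> rips X d r. \<forall>i\<in>I. \<sigma> \<inter> Y i = {}} = {\<sigma> \<in> rips X d r. \<sigma> \<subseteq> Z}"
    using disj(2) unfolding rips_iff X by blast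
  also have "\<dots> = rips Z d r" by (rule rips_restrict) (simp add: X)
  finally have Z: "{\<sigma> \<in> rips X d r. \<forall>i\<in>I. \<sigma> \<inter> Y i = {}} = rips Z d r" .
  have bX: "b i \<in> X" if "i \<in> I" for i using b[OF that] X by blast
  have "deforms (realization (rips X d r))
      (\<Union>\<sigma>\<in>{\<sigma>\<in>rips X d r. \<forall>i\<in>I. \<sigma> \<inter> Y i = {}}. face \<sigma>)
      (\<Union>\<sigma>\<in>{\<sigma>\<in>rips X d r. \<forall>i\<in>I. \<sigma> \<inter> Y i = {}}. face \<sigma>)"
  proof (rule deforms_step[OF abstract_complex_rips disj(1)])
    show "b i \<notin> Y j" if "i \<in> I" "j \<in> I" for i j using b disj(2) that by blast
    show "{b i} \<in> rips X d r" if "i \<in> I" for i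
      using bX[OF that] d(3) r by (simp add: rips_iff)
    show "contractible_space (realization {\<sigma> \<in> rips X d r. \<sigma> \<subseteq> insert (b i) (Y i)})"
      if "i \<in> I" for i
    proof (subst rips_restrict)
      show "insert (b i) (Y i) \<subseteq> X" using bX[OF that] that X by blast
    qed (rule contr[OF that])
    fix \<sigma> i assume \<sigma>: "\<sigma> \<in> rips X d r" "\<sigma> \<inter> Y i \<noteq> {}" "\<not> \<sigma> \<subseteq> Y i" and i: "i \<in> I"
    have \<sigma>': "\<sigma> \<subseteq> X" "\<And>x y. x \<in> \<sigma> \<Longrightarrow> y \<in> \<sigma> \<Longrightarrow> d x y \<le> r" using \<sigma>(1) unfolding rips_iff by blast+
    obtain y z where y: "y \<in> \<sigma>" "y \<in> Y i" and z: "z \<in> \<sigma>" "z \<notin> Y i" using \<sigma>(2,3) by blast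
    have le: "d (b i) w \<le> r" if w: "w \<in> \<sigma>" for w
    proof (cases "w \<in> Y i")
      case True
      have "d (b i) w = d w (b i)" using d(1) bX[OF i] w \<sigma>'(1) by blast
      also have "\<dots> \<le> d w z"
        using add[OF i True, of z] z \<sigma>'(1) d(2)[OF bX[OF i], of z] by force
      also have "\<dots> \<le> r" using \<sigma>'(2) w z(1) by blast
      finally show ?thesis .
    next
      case False
      have "d (b i) w \<le> d y w"
        using add[OF i y(2), of w] False w \<sigma>'(1) d(2)[OF _ bX[OF i], of y] y(1) by force
      also have "\<dots> \<le> r" using \<sigma>'(2) w y(1) by blast
      finally show ?thesis .
    qed
    moreover have "d w (b i) \<le> r" if "w \<in> \<sigma>" for w
      using le[OF that] d(1)[OF bX[OF i], of w] that \<sigma>'(1) by force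
    moreover have "d (b i) (b i) \<le> r" using d(3)[OF bX[OF i]] r by simp
    ultimately show "insert (b i) \<sigma> \<in> rips X d r"
      using \<sigma>(1) bX[OF i] unfolding rips_iff by blast
  qed
  then show ?thesis unfolding Z .
qed

section \<open>Ascending unions\<close>

text \<open>Higher stages are deformed earlier, so the time intervals accumulate at 0. The
  contraction \<open>F n\<close> of stage \<open>n\<close> rests up to time 1/(n+2), which leaves
  room for all higher stages. Since the deformations are relative, \<open>F (Suc n)\<close> extends
  \<open>F n\<close>; and a simplex of the union lies in some stage, where continuity is
  known.\<close>

lemma contractible_realization_Union:
  fixes K :: "nat \<Rightarrow> 'v set set"
  assumes mono: "\<And>n. K n \<subseteq> K (Suc n)"
    and def: "\<And>n. deforms (realization (K (Suc n))) (\<Union>\<sigma>\<in>K n. face \<sigma>) (\<Union>\<sigma>\<in>K n. face \<sigma>)"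
    and sub: "\<And>n. subtopology (realization (K (Suc n))) (\<Union>\<sigma>\<in>K n. face \<sigma>) = realization (K n)"
    and K0: "(\<Union>\<sigma>\<in>K 0. face \<sigma>) = {e}"
  shows "contractible_space (realization (\<Union>n. K n))"
proof -
  let ?I = "top_of_set {0..1::real}" and ?X = "\<lambda>n. realization (K n)"
  let ?K = "\<lambda>n. \<Union>\<sigma>\<in>K n. face \<sigma>"
  have top: "topspace (?X n) = ?K n" for n by (rule topspace_realization)
  define P where "P n F \<longleftrightarrow> continuous_map (prod_topology ?I (?X n)) (?X n) F \<and>
    (\<forall>x\<in>?K n. F (1, x) = e \<and> (\<forall>t. 0 \<le> t \<and> t \<le> 1 / (real n + 2) \<longrightarrow> F (t, x) = x))" for n F
  define Q where "Q n F F' \<longleftrightarrow> (\<forall>t\<in>{0..1}. \<forall>x\<in>?K n. F' (t, x) = F (t, x))"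
    for n and F F' :: "real \<times> ('v \<Rightarrow> real) \<Rightarrow> 'v \<Rightarrow> real"
  have "\<exists>F. \<forall>n. P n (F n) \<and> Q n (F n) (F (Suc n))"
  proof (rule dependent_nat_choice)
    have "P 0 snd" unfolding P_def K0 by (auto simp only: snd_conv continuous_map_snd)
    then show "\<exists>F. P 0 F" by blast
  next
    fix F n assume F: "P n F"
    have F_cont: "continuous_map (prod_topology ?I (?X n)) (?X n) F"
      and F_1: "\<And>x. x \<in> ?K n \<Longrightarrow> F (1, x) = e"
      and F_low: "\<And>t x. x \<in> ?K n \<Longrightarrow> 0 \<le> t \<Longrightarrow> t \<le> 1 / (real n + 2) \<Longrightarrow> F (t, x) = x"
      using F unfolding P_def by blast+
    obtain r h where r: "r ` topspace (?X (Suc n)) \<subseteq> ?K n"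
      and h: "continuous_map (prod_topology ?I (?X (Suc n))) (?X (Suc n)) h"
        "\<forall>x. h (0, x) = id x" "\<forall>x. h (1, x) = r x" "\<forall>t\<in>{0..1}. \<forall>x\<in>?K n. h (t, x) = x"
      using def[of n] unfolding deforms_def homotopic_with_def by blast
    have "continuous_map (?X (Suc n)) (?X (Suc n)) (h \<circ> Pair 1)"
      by (rule continuous_map_o_Pair[OF h(1)]) simp
    moreover have "h \<circ> Pair 1 = r" using h(3) by (simp add: fun_eq_iff)
    ultimately have r_cont: "continuous_map (?X (Suc n)) (?X n) r"
      unfolding sub[of n, symmetric] using r by (simp add: continuous_map_in_subtopology image_subset_iff_funcset)
    have r_fix: "r x = x" if "x \<in> ?K n" for x
    proof -
      have "h (1, x) = x" using bspec[OF bspec[OF h(4), of 1] that] by simp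
      then show ?thesis using h(3) by simp
    qed
    let ?P = "prod_topology ?I (?X (Suc n))"
    \<comment> \<open>The affine map taking the interval from 1/(n+3) to 1/(n+2) onto the unit
      interval, clipped outside; its slope is the reciprocal of 1/(n+2) - 1/(n+3).\<close>
    define u where "u t = max 0 (min 1 ((real n + 2) * (real n + 3) * t - (real n + 2)))" for t :: real
    define F' where "F' y = (if fst y \<le> 1 / (real n + 2) then h (u (fst y), snd y)
      else F (fst y, r (snd y)))" for y
    have u0: "u t = 0" if "t \<le> 1 / (real n + 3)" for t
    proof -
      have "(real n + 2) * ((real n + 3) * t) \<le> (real n + 2) * 1"
        using that by (intro mult_left_mono) (simp_all add: field_simps)
      then have "(real n + 2) * (real n + 3) * t - (real n + 2) \<le> 0" by (simp only: mult.assoc) simp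
      then show ?thesis unfolding u_def by linarith
    qed
    have u1: "u (1 / (real n + 2)) = 1"
    proof -
      have "(real n + 2) * (real n + 3) * (1 / (real n + 2)) - (real n + 2) = 1"
        by (simp add: field_simps)
      then show ?thesis unfolding u_def by simp
    qed
    have u01: "u t \<in> {0..1}" for t unfolding u_def by simp
    have t_cont: "continuous_map ?P euclideanreal fst"
      by (rule continuous_map_into_fulltopology[OF continuous_map_fst])
    have "continuous_map ?P (?X (Suc n)) F'"
      unfolding F'_def
    proof (rule continuous_map_cases_le[OF t_cont])
      have "continuous_map ?P euclideanreal (\<lambda>y. u (fst y))"
        unfolding u_def by (intro continuous_map_real_max continuous_map_real_min continuous_map_diff
            continuous_map_real_mult t_cont continuous_map_const[THEN iffD2]) auto
      then have "continuous_map ?P ?I (\<lambda>y. u (fst y))"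
        using u01 by (auto simp: continuous_map_in_subtopology)
      then have "continuous_map ?P ?P (\<lambda>y. (u (fst y), snd y))"
        by (intro continuous_map_pairedI continuous_map_snd)
      from continuous_map_compose[OF this h(1)]
      have "continuous_map ?P (?X (Suc n)) (\<lambda>y. h (u (fst y), snd y))" unfolding o_def .
      then show "continuous_map (subtopology ?P {y \<in> topspace ?P. fst y \<le> 1 / (real n + 2)})
          (?X (Suc n)) (\<lambda>y. h (u (fst y), snd y))"
        by (rule continuous_map_from_subtopology)
      have "continuous_map ?P (prod_topology ?I (?X n)) (\<lambda>y. (fst y, r (snd y)))"
        by (intro continuous_map_pairedI continuous_map_fst
            continuous_map_compose[OF continuous_map_snd r_cont, unfolded o_def])
      from continuous_map_compose[OF this F_cont]
      have "continuous_map ?P (?X n) (\<lambda>y. F (fst y, r (snd y)))" unfolding o_def .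
      then have "continuous_map ?P (?X (Suc n)) (\<lambda>y. F (fst y, r (snd y)))"
        unfolding sub[of n, symmetric] by (rule continuous_map_into_fulltopology)
      then show "continuous_map (subtopology ?P {y \<in> topspace ?P. 1 / (real n + 2) \<le> fst y})
          (?X (Suc n)) (\<lambda>y. F (fst y, r (snd y)))"
        by (rule continuous_map_from_subtopology)
      \<comment> \<open>At the junction the deformation has arrived at \<open>r\<close>, and
        \<open>F\<close> is at the end of its rest, so both sides are
        \<open>r (snd y)\<close>.\<close>
      fix y assume y: "y \<in> topspace ?P" "fst y = 1 / (real n + 2)"
      then have "snd y \<in> topspace (?X (Suc n))" by auto
      then have "r (snd y) \<in> ?K n" using r by blast
      then show "h (u (fst y), snd y) = F (fst y, r (snd y))"
        using F_low[of "r (snd y)" "fst y"] y(2) u1 h(3) by simp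
    qed simp
    moreover have "F' (1, x) = e" if "x \<in> ?K (Suc n)" for x
    proof -
      have "r x \<in> ?K n" using r that unfolding top by blast
      then show ?thesis using F_1 by (simp add: F'_def)
    qed
    moreover have "F' (t, x) = x" if "t \<le> 1 / (real (Suc n) + 2)" for t x
    proof -
      have "1 / (real n + 3) \<le> 1 / (real n + 2)" by (simp add: frac_le)
      then show ?thesis using that u0[of t] h(2) by (simp add: F'_def add.commute)
    qed
    ultimately have "P (Suc n) F'" unfolding P_def by blast
    moreover have "Q n F F'"
      unfolding Q_def
    proof (intro ballI)
      fix t :: real and x assume t: "t \<in> {0..1}" and x: "x \<in> ?K n"
      show "F' (t, x) = F (t, x)"
      proof (cases "t \<le> 1 / (real n + 2)")
        case True
        have "h (u t, x) = x" using h(4) u01 x by blast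
        with True show ?thesis using F_low[OF x _ True] t by (simp add: F'_def)
      qed (simp add: F'_def r_fix[OF x])
    qed
    ultimately show "\<exists>F'. P (Suc n) F' \<and> Q n F F'" by blast
  qed
  then obtain F where F: "\<And>n. P n (F n)" and F_Suc: "\<And>n. Q n (F n) (F (Suc n))" by blast
  have K_mono: "K m \<subseteq> K n" if "m \<le> n" for m n
    using that mono by (rule lift_Suc_mono_le[rotated])
  have F_le: "F n (t, x) = F m (t, x)" if "m \<le> n" "t \<in> {0..1}" "x \<in> ?K m" for m n t x
    using that(1)
  proof (induction n rule: dec_induct)
    case (step n)
    have "x \<in> ?K n" using that(3) K_mono[OF step(1)] by blast
    with F_Suc[of n] that(2) have "F (Suc n) (t, x) = F n (t, x)" unfolding Q_def by blast
    with step show ?case by simp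
  qed simp
  \<comment> \<open>The least stage is only a definite choice; by \<open>F_le\<close> every stage
    containing the point gives the same value.\<close>
  define G where "G y = F (LEAST n. snd y \<in> ?K n) y" for y
  have G: "G (t, x) = F n (t, x)" if "t \<in> {0..1}" "x \<in> ?K n" for t x n
  proof -
    have "(LEAST n. x \<in> ?K n) \<le> n" "x \<in> ?K (LEAST n. x \<in> ?K n)"
      using that(2) by (rule Least_le, rule LeastI)
    then show ?thesis unfolding G_def using F_le that(1) by simp
  qed
  let ?XX = "realization (\<Union>n. K n)"
  have "continuous_map (prod_topology ?I ?XX) ?XX G"
  proof (rule continuous_map_prod_realization)
    show "locally_compact_space ?I"
      by (simp add: compact_imp_locally_compact_space compact_space_subtopology)
    show "Hausdorff_space ?I" by (simp add: Hausdorff_space_subtopology)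
    fix \<sigma> assume "\<sigma> \<in> (\<Union>n. K n)"
    then obtain n where n: "\<sigma> \<in> K n" by blast
    let ?P = "prod_topology ?I (top_of_set (face \<sigma>))"
    have F_cont: "continuous_map (prod_topology ?I (?X n)) (?X n) (F n)"
      using F[of n] unfolding P_def by blast
    have "continuous_map ?P (prod_topology ?I (?X n)) (\<lambda>y. (fst y, id (snd y)))"
      by (intro continuous_map_pairedI continuous_map_fst
          continuous_map_compose[OF continuous_map_snd continuous_map_face_realization[OF n],
            unfolded o_def])
    from continuous_map_compose[OF continuous_map_compose[OF this F_cont]
        continuous_map_realization_mono[of "K n" "\<Union>n. K n"]]
    have "continuous_map ?P ?XX (\<lambda>y. F n y)"
      by (simp only: o_def id_apply prod.collapse UN_upper UNIV_I)
    then show "continuous_map ?P ?XX G"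
    proof (rule continuous_map_eq)
      fix y assume "y \<in> topspace ?P"
      then have "fst y \<in> {0..1}" "snd y \<in> ?K n" using n by auto
      then show "F n y = G y" using G[of "fst y" "snd y" n] by simp
    qed
  qed
  moreover have "G (0, x) = x \<and> G (1, x) = e" if x: "x \<in> topspace ?XX" for x
  proof -
    obtain n where "x \<in> ?K n" using x unfolding topspace_realization by blast
    then have "G (0, x) = F n (0, x)" "G (1, x) = F n (1, x)" "F n (1, x) = e" "F n (0, x) = x"
      using F[of n] G[of _ x n] unfolding P_def by auto
    then show ?thesis by simp
  qed
  ultimately have "homotopic_with (\<lambda>x. True) ?XX ?XX id (\<lambda>x. e)"
    by (subst homotopic_with) (auto intro!: exI[of _ G])
  then show ?thesis unfolding contractible_space_def by blast
qed

section \<open>Word norms\<close>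

text \<open>The minimum in \<open>word_dist\<close>, isolated as a natural number. The empty word
  gives the identity norm 0, so the separate clause for equal elements is absorbed.\<close>

definition word_norm :: "('a, 'm) monoid_scheme \<Rightarrow> 'a set \<Rightarrow> 'a \<Rightarrow> nat" where
  "word_norm G S g = (LEAST k. \<exists>xs. length xs = k \<and> set xs \<subseteq> S \<union> m_inv G ` S \<and>
     g = foldr (\<otimes>\<^bsub>G\<^esub>) xs \<one>\<^bsub>G\<^esub>)"

lemma (in monoid) foldr_mult_closed: "set xs \<subseteq> carrier G \<Longrightarrow> foldr (\<otimes>) xs \<one> \<in> carrier G"
  by (induction xs) auto

lemma (in monoid) foldr_mult_append:
  assumes "set xs \<subseteq> carrier G" "set ys \<subseteq> carrier G"
  shows "foldr (\<otimes>) (xs @ ys) \<one> = foldr (\<otimes>) xs \<one> \<otimes> foldr (\<otimes>) ys \<one>"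
  using assms(1) by (induction xs) (auto simp: m_assoc foldr_mult_closed assms(2))

lemma (in group) inv_foldr_mult:
  "set xs \<subseteq> carrier G \<Longrightarrow> inv (foldr (\<otimes>) xs \<one>) = foldr (\<otimes>) (rev (map (m_inv G) xs)) \<one>"
proof (induction xs)
  case (Cons x xs)
  then have "set (rev (map (m_inv G) xs)) \<subseteq> carrier G" by auto
  then show ?case using Cons foldr_mult_append[of "rev (map (m_inv G) xs)" "[inv x]"]
    by (simp add: inv_mult_group foldr_mult_closed del: foldr_append)
qed simp

lemma word_norm_le:
  "set xs \<subseteq> S \<union> m_inv G ` S \<Longrightarrow> word_norm G S (foldr (\<otimes>\<^bsub>G\<^esub>) xs \<one>\<^bsub>G\<^esub>) \<le> length xs"
  unfolding word_norm_def by (rule Least_le) blast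

lemma word_norm_one: "word_norm G S \<one>\<^bsub>G\<^esub> = 0"
  using word_norm_le[of "[]" S G] by simp

lemma generators_closed:
  assumes "marked_group G S"
  shows "S \<union> m_inv G ` S \<subseteq> carrier G"
  using assms by (auto simp: marked_group_def subset_iff)

lemma marked_group_word:
  assumes G: "marked_group G S" and g: "g \<in> carrier G"
  shows "\<exists>xs. set xs \<subseteq> S \<union> m_inv G ` S \<and> g = foldr (\<otimes>\<^bsub>G\<^esub>) xs \<one>\<^bsub>G\<^esub>"
proof -
  interpret group G using G by (simp add: marked_group_def)
  have S: "S \<subseteq> carrier G" using G by (simp add: marked_group_def)
  note gen = generators_closed[OF G]
  have "g \<in> generate G S" using G g by (simp add: marked_group_def)
  then show ?thesis
  proof induction
    case one
    then show ?case by (intro exI[of _ "[]"]) simp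
  next
    case (incl h)
    then show ?case using S by (intro exI[of _ "[h]"]) auto
  next
    case (inv h)
    then show ?case using S by (intro exI[of _ "[m_inv G h]"]) auto
  next
    case (eng h1 h2)
    then obtain xs ys where "set xs \<subseteq> S \<union> m_inv G ` S" "h1 = foldr (\<otimes>\<^bsub>G\<^esub>) xs \<one>\<^bsub>G\<^esub>"
        "set ys \<subseteq> S \<union> m_inv G ` S" "h2 = foldr (\<otimes>\<^bsub>G\<^esub>) ys \<one>\<^bsub>G\<^esub>" by blast
    moreover from this gen have "set xs \<subseteq> carrier G" "set ys \<subseteq> carrier G" by blast+
    ultimately show ?case by (intro exI[of _ "xs @ ys"]) (simp add: foldr_mult_append del: foldr_append)
  qed
qed

lemma word_norm_attained:
  assumes "marked_group G S" "g \<in> carrier G"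
  obtains xs where "length xs = word_norm G S g" "set xs \<subseteq> S \<union> m_inv G ` S"
    "g = foldr (\<otimes>\<^bsub>G\<^esub>) xs \<one>\<^bsub>G\<^esub>"
proof -
  have "\<exists>k xs. length xs = k \<and> set xs \<subseteq> S \<union> m_inv G ` S \<and> g = foldr (\<otimes>\<^bsub>G\<^esub>) xs \<one>\<^bsub>G\<^esub>"
    using marked_group_word[OF assms] by blast
  then have "\<exists>xs. length xs = word_norm G S g \<and> set xs \<subseteq> S \<union> m_inv G ` S \<and>
      g = foldr (\<otimes>\<^bsub>G\<^esub>) xs \<one>\<^bsub>G\<^esub>"
    unfolding word_norm_def by (rule LeastI_ex)
  then show thesis using that by blast
qed

lemma word_norm_generator_mult:
  assumes "marked_group G S" "s \<in> S \<union> m_inv G ` S" "g \<in> carrier G"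
  shows "word_norm G S (s \<otimes>\<^bsub>G\<^esub> g) \<le> Suc (word_norm G S g)"
proof -
  obtain xs where xs: "length xs = word_norm G S g" "set xs \<subseteq> S \<union> m_inv G ` S"
      "g = foldr (\<otimes>\<^bsub>G\<^esub>) xs \<one>\<^bsub>G\<^esub>" using word_norm_attained[OF assms(1,3)] .
  with assms(2) word_norm_le[of "s # xs" S G] show ?thesis by simp
qed

lemma word_norm_inv:
  assumes G: "marked_group G S" and g: "g \<in> carrier G"
  shows "word_norm G S (inv\<^bsub>G\<^esub> g) = word_norm G S g"
proof -
  interpret group G using G by (simp add: marked_group_def)
  have S: "S \<subseteq> carrier G" using G by (simp add: marked_group_def)
  have le: "word_norm G S (inv\<^bsub>G\<^esub> h) \<le> word_norm G S h" if h: "h \<in> carrier G" for h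
  proof -
    obtain xs where xs: "length xs = word_norm G S h" "set xs \<subseteq> S \<union> m_inv G ` S"
      "h = foldr (\<otimes>\<^bsub>G\<^esub>) xs \<one>\<^bsub>G\<^esub>" using word_norm_attained[OF G h] .
    have "inv\<^bsub>G\<^esub> x \<in> S \<union> m_inv G ` S" if "x \<in> S \<union> m_inv G ` S" for x
      using that S by (auto simp: subset_iff)
    then have "set (rev (map (m_inv G) xs)) \<subseteq> S \<union> m_inv G ` S"
      using xs(2) unfolding set_rev set_map by blast
    from word_norm_le[OF this] show ?thesis
      using xs inv_foldr_mult[of xs] generators_closed[OF G] by (simp add: subset_trans)
  qed
  show ?thesis using le[OF g] le[OF inv_closed[OF g]] g by simp
qed

lemma word_dist_eq:
  assumes "group G" "g \<in> carrier G" "h \<in> carrier G"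
  shows "word_dist G S g h = real (word_norm G S (inv\<^bsub>G\<^esub> g \<otimes>\<^bsub>G\<^esub> h))"
proof -
  interpret group G by fact
  show ?thesis
    using assms word_norm_one[of G S] unfolding word_dist_def word_norm_def by auto
qed

lemma word_dist_commute:
  assumes "marked_group G S" "g \<in> carrier G" "h \<in> carrier G"
  shows "word_dist G S g h = word_dist G S h g"
proof -
  interpret group G using assms by (simp add: marked_group_def)
  have "inv\<^bsub>G\<^esub> (inv\<^bsub>G\<^esub> g \<otimes>\<^bsub>G\<^esub> h) = inv\<^bsub>G\<^esub> h \<otimes>\<^bsub>G\<^esub> g" using assms by (simp add: inv_mult_group)
  then show ?thesis
    using word_norm_inv[OF assms(1), of "inv\<^bsub>G\<^esub> g \<otimes>\<^bsub>G\<^esub> h"] assms by (simp add: word_dist_eq is_group)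
qed

lemma word_dist_left_mult:
  assumes "group G" "w \<in> carrier G" "g \<in> carrier G" "h \<in> carrier G"
  shows "word_dist G S (w \<otimes>\<^bsub>G\<^esub> g) (w \<otimes>\<^bsub>G\<^esub> h) = word_dist G S g h"
proof -
  interpret group G by fact
  have "inv\<^bsub>G\<^esub> (w \<otimes>\<^bsub>G\<^esub> g) \<otimes>\<^bsub>G\<^esub> (w \<otimes>\<^bsub>G\<^esub> h) = inv\<^bsub>G\<^esub> g \<otimes>\<^bsub>G\<^esub> (inv\<^bsub>G\<^esub> w \<otimes>\<^bsub>G\<^esub> (w \<otimes>\<^bsub>G\<^esub> h))"
    using assms by (simp add: inv_mult_group m_assoc)
  also have "inv\<^bsub>G\<^esub> w \<otimes>\<^bsub>G\<^esub> (w \<otimes>\<^bsub>G\<^esub> h) = h" using assms by (simp add: m_assoc[symmetric])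
  finally show ?thesis using assms by (simp add: word_dist_eq)
qed

section \<open>Word norms in free products\<close>

lemma carrier_free_product: "carrier (free_product A B) = reduced_words A B"
  by (simp add: free_product_def)

lemma one_free_product: "\<one>\<^bsub>free_product A B\<^esub> = []"
  by (simp add: free_product_def)

lemma mult_free_product: "u \<otimes>\<^bsub>free_product A B\<^esub> v = foldr (letter_mult A B) u v"
  by (simp add: free_product_def)

lemma reduced_append:
  "u @ v \<in> reduced_words A B \<longleftrightarrow> u \<in> reduced_words A B \<and> v \<in> reduced_words A B \<and>
     (u = [] \<or> v = [] \<or> isl (last u) \<noteq> isl (hd v))"
  by (auto simp: reduced_words_def successively_append_iff)

lemma letter_mult_reduced:
  assumes "x # v \<in> reduced_words A B"
  shows "letter_mult A B x v = x # v"
  using assms by (cases x; cases v; cases "hd v")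
    (auto simp: reduced_Cons free_inl_def free_inr_def)

lemma mult_reduced_append:
  "u @ v \<in> reduced_words A B \<Longrightarrow> u \<otimes>\<^bsub>free_product A B\<^esub> v = u @ v"
proof (induction u)
  case (Cons x u)
  then have "x # (u @ v) \<in> reduced_words A B" "u @ v \<in> reduced_words A B"
    by (simp_all add: reduced_Cons)
  with Cons.IH show ?case by (simp add: mult_free_product letter_mult_reduced)
qed (simp add: mult_free_product)

fun letter_norm where
  "letter_norm A S_A B S_B (Inl a) = word_norm A S_A a"
| "letter_norm A S_A B S_B (Inr b) = word_norm B S_B b"

definition syllable_norm where
  "syllable_norm A S_A B S_B w = sum_list (map (letter_norm A S_A B S_B) w)"

lemma syllable_norm_simps [simp]:
  "syllable_norm A S_A B S_B [] = 0"
  "syllable_norm A S_A B S_B (x # w) = letter_norm A S_A B S_B x + syllable_norm A S_A B S_B w"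
  "syllable_norm A S_A B S_B (u @ w) = syllable_norm A S_A B S_B u + syllable_norm A S_A B S_B w"
  by (simp_all add: syllable_norm_def)

lemma syllable_norm_free_inl [simp]: "syllable_norm A S_A B S_B (free_inl A a) = word_norm A S_A a"
  by (simp add: free_inl_def word_norm_one)

lemma syllable_norm_free_inr [simp]: "syllable_norm A S_A B S_B (free_inr B b) = word_norm B S_B b"
  by (simp add: free_inr_def word_norm_one)

lemma foldr_mult_hom:
  assumes h: "h \<in> hom G H" and G: "monoid G" and H: "group H" "group G" and xs: "set xs \<subseteq> carrier G"
  shows "foldr (\<otimes>\<^bsub>H\<^esub>) (map h xs) \<one>\<^bsub>H\<^esub> = h (foldr (\<otimes>\<^bsub>G\<^esub>) xs \<one>\<^bsub>G\<^esub>)"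
  using xs
proof (induction xs)
  case Nil
  then show ?case using hom_one[OF h H(2,1)] by simp
next
  case (Cons x xs)
  then show ?case using monoid.foldr_mult_closed[OF G, of xs] hom_mult[OF h] by simp
qed

locale marked_free_product =
  fixes A :: "('a, 'm) monoid_scheme" and B :: "('b, 'n) monoid_scheme"
    and S_A :: "'a set" and S_B :: "'b set"
  assumes A: "marked_group A S_A" and B: "marked_group B S_B"
begin

abbreviation "G \<equiv> free_product A B"
abbreviation "S \<equiv> free_inl A ` S_A \<union> free_inr B ` S_B"
abbreviation "norm_G \<equiv> syllable_norm A S_A B S_B"

lemma groups: "group A" "group B" "group G"
  using A B group_free_product by (auto simp: marked_group_def)

lemma homs: "free_inl A \<in> hom A G" "free_inr B \<in> hom B G"
  using groups free_inl_hom free_inr_hom by blast+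

lemma inv_free_inl: "a \<in> carrier A \<Longrightarrow> inv\<^bsub>G\<^esub> (free_inl A a) = free_inl A (inv\<^bsub>A\<^esub> a)"
  using group_hom.hom_inv[of A G "free_inl A" a] groups homs
  by (simp add: group_hom_def group_hom_axioms_def)

lemma inv_free_inr: "b \<in> carrier B \<Longrightarrow> inv\<^bsub>G\<^esub> (free_inr B b) = free_inr B (inv\<^bsub>B\<^esub> b)"
  using group_hom.hom_inv[of B G "free_inr B" b] groups homs
  by (simp add: group_hom_def group_hom_axioms_def)

lemma S_sub: "S_A \<subseteq> carrier A" "S_B \<subseteq> carrier B" "S \<subseteq> carrier G"
proof -
  show "S_A \<subseteq> carrier A" "S_B \<subseteq> carrier B" using A B by (simp_all add: marked_group_def)
  then show "S \<subseteq> carrier G" using hom_in_carrier[OF homs(1)] hom_in_carrier[OF homs(2)] by blast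
qed

lemma generators_eq: "S \<union> m_inv G ` S =
  free_inl A ` (S_A \<union> m_inv A ` S_A) \<union> free_inr B ` (S_B \<union> m_inv B ` S_B)"
proof -
  have "m_inv G ` free_inl A ` S_A = free_inl A ` m_inv A ` S_A"
    unfolding image_image by (rule image_cong[OF refl]) (use S_sub inv_free_inl in blast)
  moreover have "m_inv G ` free_inr B ` S_B = free_inr B ` m_inv B ` S_B"
    unfolding image_image by (rule image_cong[OF refl]) (use S_sub inv_free_inr in blast)
  ultimately show ?thesis by (simp add: image_Un Un_ac)
qed

text \<open>A generator is at most one letter, and it affects only the front of the word: either it
  becomes a new syllable of norm at most 1, or it merges with the first syllable, where the estimate
  inside the factor applies, also when the merged syllable disappears. This is the lower bound for
  word norms.\<close>

lemma norm_G_generator_mult: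
  assumes s: "s \<in> S \<union> m_inv G ` S" and w: "w \<in> reduced_words A B"
  shows "norm_G (s \<otimes>\<^bsub>G\<^esub> w) \<le> Suc (norm_G w)"
proof -
  interpret A: group A by (rule groups)
  interpret B: group B by (rule groups)
  from s[unfolded generators_eq] show ?thesis
  proof
    assume "s \<in> free_inl A ` (S_A \<union> m_inv A ` S_A)"
    then obtain a where a: "a \<in> S_A \<union> m_inv A ` S_A" "s = free_inl A a" by blast
    then have ac: "a \<in> carrier A" using generators_closed[OF A] by blast
    have "word_norm A S_A a \<le> 1"
      using word_norm_generator_mult[OF A a(1) A.one_closed] ac by (simp add: word_norm_one)
    moreover have "s \<otimes>\<^bsub>G\<^esub> w = letter_mult A B (Inl a) w"
      using a(2) foldr_free_inl[OF groups(1,2) ac w] by (simp add: mult_free_product)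
    moreover have "word_norm A S_A (a \<otimes>\<^bsub>A\<^esub> a') \<le> Suc (word_norm A S_A a')" if "a' \<in> carrier A" for a'
      using word_norm_generator_mult[OF A a(1) that] .
    ultimately show ?thesis
      using w by (cases w; cases "hd w") (auto simp: reduced_Cons)
  next
    assume "s \<in> free_inr B ` (S_B \<union> m_inv B ` S_B)"
    then obtain b where b: "b \<in> S_B \<union> m_inv B ` S_B" "s = free_inr B b" by blast
    then have bc: "b \<in> carrier B" using generators_closed[OF B] by blast
    have "word_norm B S_B b \<le> 1"
      using word_norm_generator_mult[OF B b(1) B.one_closed] bc by (simp add: word_norm_one)
    moreover have "s \<otimes>\<^bsub>G\<^esub> w = letter_mult A B (Inr b) w"
      using b(2) foldr_free_inr[OF groups(1,2) bc w] by (simp add: mult_free_product)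
    moreover have "word_norm B S_B (b \<otimes>\<^bsub>B\<^esub> b') \<le> Suc (word_norm B S_B b')" if "b' \<in> carrier B" for b'
      using word_norm_generator_mult[OF B b(1) that] .
    ultimately show ?thesis
      using w by (cases w; cases "hd w") (auto simp: reduced_Cons)
  qed
qed

text \<open>Each syllable is spelled by a shortest word of its factor. This gives both the upper
  bound for word norms and the fact that \<open>S\<close> generates.\<close>

lemma reduced_word_expansion:
  assumes "w \<in> reduced_words A B"
  shows "\<exists>xs. length xs = norm_G w \<and> set xs \<subseteq> S \<union> m_inv G ` S \<and> w = foldr (\<otimes>\<^bsub>G\<^esub>) xs \<one>\<^bsub>G\<^esub>"
  using assms
proof (induction w)
  case Nil
  then show ?case by (simp add: one_free_product)
next
  case (Cons x w)
  interpret G: group G by (rule groups)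
  have w: "w \<in> reduced_words A B" using Cons.prems by (simp add: reduced_Cons)
  then obtain ys where ys: "length ys = norm_G w" "set ys \<subseteq> S \<union> m_inv G ` S"
      "w = foldr (\<otimes>\<^bsub>G\<^esub>) ys \<one>\<^bsub>G\<^esub>" using Cons.IH by blast
  obtain xs where xs: "length xs = letter_norm A S_A B S_B x" "set xs \<subseteq> S \<union> m_inv G ` S"
      "[x] = foldr (\<otimes>\<^bsub>G\<^esub>) xs \<one>\<^bsub>G\<^esub>"
  proof (cases x)
    case (Inl a)
    then have a: "a \<in> carrier A" "a \<noteq> \<one>\<^bsub>A\<^esub>" using Cons.prems by (auto simp: reduced_Cons)
    obtain zs where zs: "length zs = word_norm A S_A a" "set zs \<subseteq> S_A \<union> m_inv A ` S_A"
        "a = foldr (\<otimes>\<^bsub>A\<^esub>) zs \<one>\<^bsub>A\<^esub>" using word_norm_attained[OF A a(1)] .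
    have "foldr (\<otimes>\<^bsub>G\<^esub>) (map (free_inl A) zs) \<one>\<^bsub>G\<^esub> = free_inl A a"
      using foldr_mult_hom[OF homs(1) _ groups(3,1), of zs] zs generators_closed[OF A]
        group.is_monoid[OF groups(1)] by (metis subset_trans)
    moreover have "set (map (free_inl A) zs) \<subseteq> S \<union> m_inv G ` S"
      unfolding generators_eq set_map using zs(2) by blast
    ultimately show thesis
      using zs(1) Inl a by (intro that[of "map (free_inl A) zs"]) (simp_all add: free_inl_def)
  next
    case (Inr b)
    then have b: "b \<in> carrier B" "b \<noteq> \<one>\<^bsub>B\<^esub>" using Cons.prems by (auto simp: reduced_Cons)
    obtain zs where zs: "length zs = word_norm B S_B b" "set zs \<subseteq> S_B \<union> m_inv B ` S_B"
        "b = foldr (\<otimes>\<^bsub>B\<^esub>) zs \<one>\<^bsub>B\<^esub>" using word_norm_attained[OF B b(1)] .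
    have "foldr (\<otimes>\<^bsub>G\<^esub>) (map (free_inr B) zs) \<one>\<^bsub>G\<^esub> = free_inr B b"
      using foldr_mult_hom[OF homs(2) _ groups(3,2), of zs] zs generators_closed[OF B]
        group.is_monoid[OF groups(2)] by (metis subset_trans)
    moreover have "set (map (free_inr B) zs) \<subseteq> S \<union> m_inv G ` S"
      unfolding generators_eq set_map using zs(2) by blast
    ultimately show thesis
      using zs(1) Inr b by (intro that[of "map (free_inr B) zs"]) (simp_all add: free_inr_def)
  qed
  have gen: "S \<union> m_inv G ` S \<subseteq> carrier G" using S_sub(3) by (auto simp: subset_iff)
  have "x # w = [x] \<otimes>\<^bsub>G\<^esub> w" using mult_reduced_append[of "[x]" w A B] Cons.prems by simp
  also have "\<dots> = foldr (\<otimes>\<^bsub>G\<^esub>) (xs @ ys) \<one>\<^bsub>G\<^esub>"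
    using xs(2,3) ys(2,3) gen by (subst G.foldr_mult_append) (auto simp: subset_trans)
  finally have "x # w = foldr (\<otimes>\<^bsub>G\<^esub>) (xs @ ys) \<one>\<^bsub>G\<^esub>" .
  moreover have "length (xs @ ys) = norm_G (x # w)" using xs(1) ys(1) by simp
  moreover have "set (xs @ ys) \<subseteq> S \<union> m_inv G ` S" using xs(2) ys(2) by simp
  ultimately show ?case by blast
qed

lemma marked_group_free_product: "marked_group G S"
proof -
  interpret G: group G by (rule groups)
  have "g \<in> generate G S" if g: "g \<in> carrier G" for g
  proof -
    obtain xs where xs: "set xs \<subseteq> S \<union> m_inv G ` S" "g = foldr (\<otimes>\<^bsub>G\<^esub>) xs \<one>\<^bsub>G\<^esub>"
      using reduced_word_expansion g unfolding carrier_free_product by blast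
    have "foldr (\<otimes>\<^bsub>G\<^esub>) xs \<one>\<^bsub>G\<^esub> \<in> generate G S"
      using xs(1) by (induction xs) (auto intro: generate.intros)
    then show ?thesis using xs(2) by simp
  qed
  moreover have "finite S" using A B by (simp add: marked_group_def)
  ultimately show ?thesis
    using groups(3) S_sub(3) G.generate_incl[OF S_sub(3)] unfolding marked_group_def by blast
qed

text \<open>For the nontrivial inequality, a shortest word is multiplied out one generator at a
  time; the syllable norm starts at 0 and grows by at most 1 per generator.\<close>

lemma word_norm_free_product:
  assumes "w \<in> reduced_words A B"
  shows "word_norm G S w = norm_G w"
proof (rule antisym)
  interpret G: group G by (rule groups)
  show "word_norm G S w \<le> norm_G w"
    using reduced_word_expansion[OF assms] word_norm_le by metis
  obtain xs where xs: "length xs = word_norm G S w" "set xs \<subseteq> S \<union> m_inv G ` S"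
      "w = foldr (\<otimes>\<^bsub>G\<^esub>) xs \<one>\<^bsub>G\<^esub>"
    using word_norm_attained[OF marked_group_free_product] assms
    unfolding carrier_free_product by blast
  have "norm_G (foldr (\<otimes>\<^bsub>G\<^esub>) xs \<one>\<^bsub>G\<^esub>) \<le> length xs" using xs(2)
  proof (induction xs)
    case (Cons s xs)
    have "set xs \<subseteq> carrier G"
      using subset_trans[OF _ generators_closed[OF marked_group_free_product], of "set xs"] Cons.prems
      by simp
    then have "foldr (\<otimes>\<^bsub>G\<^esub>) xs \<one>\<^bsub>G\<^esub> \<in> reduced_words A B"
      using G.foldr_mult_closed unfolding carrier_free_product by blast
    then show ?case
      using norm_G_generator_mult[of s "foldr (\<otimes>\<^bsub>G\<^esub>) xs \<one>\<^bsub>G\<^esub>"] Cons by auto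
  qed (simp add: one_free_product)
  with xs show "norm_G w \<le> word_norm G S w" by simp
qed

end

section \<open>Isometric relabelling\<close>

text \<open>Barycentric coordinates pull back, so the map on points goes against \<open>g\<close> on
  vertices. The value 0 off \<open>W\<close> is required because coordinates are indexed by the
  whole vertex type.\<close>

definition relabel :: "'w set \<Rightarrow> ('w \<Rightarrow> 'v) \<Rightarrow> ('v \<Rightarrow> real) \<Rightarrow> 'w \<Rightarrow> real" where
  "relabel W g p = (\<lambda>w. if w \<in> W then p (g w) else 0)"

text \<open>\<tau> has to be the full preimage of \<sigma> in \<open>W\<close>: otherwise the
  pulled-back point would have weight outside \<open>face \<tau>\<close>.\<close>

lemma continuous_map_relabel:
  assumes "\<And>\<sigma>. \<sigma> \<in> K \<Longrightarrow> \<exists>\<tau>\<in>L. \<tau> \<subseteq> W \<and> bij_betw g \<tau> \<sigma> \<and> (\<forall>w\<in>W. g w \<in> \<sigma> \<longrightarrow> w \<in> \<tau>)"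
  shows "continuous_map (realization K) (realization L) (relabel W g)"
proof (rule continuous_map_realization)
  fix \<sigma> assume "\<sigma> \<in> K"
  from assms[OF this] obtain \<tau> where \<tau>: "\<tau> \<in> L" "\<tau> \<subseteq> W" "bij_betw g \<tau> \<sigma>"
    "\<And>w. w \<in> W \<Longrightarrow> g w \<in> \<sigma> \<Longrightarrow> w \<in> \<tau>" by blast
  have "continuous_on (face \<sigma>) (\<lambda>p. relabel W g p w)" for w
    by (cases "w \<in> W") (simp_all add: relabel_def continuous_on_coordinate)
  then have "continuous_on (face \<sigma>) (relabel W g)"
    by (rule continuous_on_coordinatewise_then_product)
  moreover have "relabel W g p \<in> face \<tau>" if p: "p \<in> face \<sigma>" for p
  proof -
    have "(\<Sum>w\<in>\<tau>. relabel W g p w) = (\<Sum>w\<in>\<tau>. p (g w))"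
      using \<tau>(2) by (intro sum.cong) (auto simp: relabel_def)
    also have "\<dots> = (\<Sum>v\<in>\<sigma>. p v)" using \<tau>(3) by (rule sum.reindex_bij_betw)
    finally have "(\<Sum>w\<in>\<tau>. relabel W g p w) = 1" using p by (simp add: face_def)
    moreover have "relabel W g p w = 0" if "w \<notin> \<tau>" for w
      using \<tau>(4)[of w] that p by (auto simp: relabel_def face_def)
    ultimately show ?thesis using p by (auto simp: face_def relabel_def)
  qed
  ultimately show "continuous_map (top_of_set (face \<sigma>)) (realization L) (relabel W g)"
    by (intro continuous_map_into_realization[OF \<tau>(1)]) auto
qed

text \<open>Transfers the hypothesis on a factor to its copies in the free product, whose vertices
  have another type: pulling back along \<open>f\<close> and along its inverse are mutually inverse
  homeomorphisms.\<close>

lemma contractible_rips_isometric: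
  assumes f: "inj_on f Z" and d: "\<And>x y. x \<in> Z \<Longrightarrow> y \<in> Z \<Longrightarrow> d (f x) (f y) = d' x y"
    and contr: "contractible_space (realization (rips Z d' r))"
  shows "contractible_space (realization (rips (f ` Z) d r))"
proof -
  define g where "g = inv_into Z f"
  have g: "g (f z) = z" if "z \<in> Z" for z using f that by (simp add: g_def)
  have "continuous_map (realization (rips Z d' r)) (realization (rips (f ` Z) d r)) (relabel (f ` Z) g)"
  proof (rule continuous_map_relabel)
    fix \<sigma> assume \<sigma>: "\<sigma> \<in> rips Z d' r"
    then have sub: "\<sigma> \<subseteq> Z" unfolding rips_iff by blast
    have "f ` \<sigma> \<in> rips (f ` Z) d r"
      using \<sigma> d sub unfolding rips_iff by (auto simp: subset_iff)
    moreover have "bij_betw g (f ` \<sigma>) \<sigma>"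
      using sub g by (intro bij_betw_byWitness[where f' = f]) auto
    moreover have "\<forall>w\<in>f ` Z. g w \<in> \<sigma> \<longrightarrow> w \<in> f ` \<sigma>" using g by auto
    ultimately show "\<exists>\<tau>\<in>rips (f ` Z) d r. \<tau> \<subseteq> f ` Z \<and> bij_betw g \<tau> \<sigma> \<and> (\<forall>w\<in>f ` Z. g w \<in> \<sigma> \<longrightarrow> w \<in> \<tau>)"
      using image_mono[OF sub] by (intro bexI[of _ "f ` \<sigma>"] conjI)
  qed
  moreover have "continuous_map (realization (rips (f ` Z) d r)) (realization (rips Z d' r)) (relabel Z f)"
  proof (rule continuous_map_relabel)
    fix \<sigma> assume \<sigma>: "\<sigma> \<in> rips (f ` Z) d r"
    define \<tau> where "\<tau> = {z\<in>Z. f z \<in> \<sigma>}"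
    have sub: "\<tau> \<subseteq> Z" and im: "f ` \<tau> = \<sigma>" using \<sigma> unfolding \<tau>_def rips_iff by blast+
    have bij: "bij_betw f \<tau> \<sigma>"
      using im inj_on_subset[OF f sub] by (simp add: bij_betw_def)
    have "\<tau> \<in> rips Z d' r"
      unfolding rips_iff
    proof (intro conjI ballI sub)
      show "\<tau> \<noteq> {}" "finite \<tau>" using \<sigma> im bij_betw_finite[OF bij] unfolding rips_iff by auto
      fix x y assume xy: "x \<in> \<tau>" "y \<in> \<tau>"
      then have "d (f x) (f y) \<le> r" using \<sigma> im unfolding rips_iff by blast
      moreover have "x \<in> Z" "y \<in> Z" using xy sub by blast+
      ultimately show "d' x y \<le> r" using d by simp
    qed
    moreover have "\<forall>z\<in>Z. f z \<in> \<sigma> \<longrightarrow> z \<in> \<tau>" unfolding \<tau>_def by blast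
    ultimately show "\<exists>\<tau>\<in>rips Z d' r. \<tau> \<subseteq> Z \<and> bij_betw f \<tau> \<sigma> \<and> (\<forall>z\<in>Z. f z \<in> \<sigma> \<longrightarrow> z \<in> \<tau>)"
      using sub bij by (intro bexI[of _ \<tau>] conjI)
  qed
  moreover have "relabel Z f (relabel (f ` Z) g p) = p" if p: "p \<in> topspace (realization (rips Z d' r))" for p
  proof -
    obtain \<sigma> where \<sigma>: "\<sigma> \<in> rips Z d' r" "p \<in> face \<sigma>"
      using p unfolding topspace_realization by blast
    then have "\<sigma> \<subseteq> Z" by (simp add: rips_iff)
    then have "p v = 0" if "v \<notin> Z" for v using that \<sigma>(2) unfolding face_def by blast
    then show ?thesis using g by (auto simp: relabel_def fun_eq_iff)
  qed
  moreover have "relabel (f ` Z) g (relabel Z f p) = p"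
    if p: "p \<in> topspace (realization (rips (f ` Z) d r))" for p
  proof -
    obtain \<sigma> where \<sigma>: "\<sigma> \<in> rips (f ` Z) d r" "p \<in> face \<sigma>"
      using p unfolding topspace_realization by blast
    then have "\<sigma> \<subseteq> f ` Z" by (simp add: rips_iff)
    then have "p v = 0" if "v \<notin> f ` Z" for v using that \<sigma>(2) unfolding face_def by blast
    then show ?thesis using g by (auto simp: relabel_def fun_eq_iff)
  qed
  ultimately have "homeomorphic_maps (realization (rips Z d' r)) (realization (rips (f ` Z) d r))
      (relabel (f ` Z) g) (relabel Z f)"
    unfolding homeomorphic_maps_def by blast
  then show ?thesis
    using contr homeomorphic_space_contractibility unfolding homeomorphic_space_def by blast
qed

section \<open>Filtration of the free product by syllable length\<close>

context marked_free_product
begin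

definition short_words :: "nat \<Rightarrow> ('a + 'b) list set" where
  "short_words n = {w \<in> reduced_words A B. length w \<le> n}"

text \<open>The flag \<open>t\<close> names the factor of the syllable to be appended, true for
  \<open>A\<close>. A nonempty word admits only the factor it does not end in; the empty word admits
  both.\<close>

definition branch_index :: "nat \<Rightarrow> (('a + 'b) list \<times> bool) set" where
  "branch_index n = {(w, t). w \<in> reduced_words A B \<and> length w = n \<and> (w = [] \<or> isl (last w) \<noteq> t)}"

text \<open>A coset of a factor without its base point \<open>fst i\<close>, so that it is disjoint
  from the shorter words, as \<open>deforms_rips\<close> demands.\<close>

definition branch :: "('a + 'b) list \<times> bool \<Rightarrow> ('a + 'b) list set" where
  "branch i = {fst i @ [x] | x. [x] \<in> reduced_words A B \<and> isl x = snd i}"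

abbreviation "dist_G \<equiv> word_dist G S"

lemma short_words_Suc: "short_words (Suc n) = short_words n \<union> (\<Union>i\<in>branch_index n. branch i)"
proof
  show "short_words (Suc n) \<subseteq> short_words n \<union> (\<Union>i\<in>branch_index n. branch i)"
  proof
    fix w assume w: "w \<in> short_words (Suc n)"
    show "w \<in> short_words n \<union> (\<Union>i\<in>branch_index n. branch i)"
    proof (cases "length w \<le> n")
      case False
      then obtain u x where u: "w = u @ [x]" using w by (cases w rule: rev_cases) auto
      with w False have *: "u @ [x] \<in> reduced_words A B" "length u = n"
        by (auto simp: short_words_def)
      then have "(u, isl x) \<in> branch_index n" "w \<in> branch (u, isl x)"
        using u by (auto simp: reduced_append branch_index_def branch_def)
      then show ?thesis by blast
    qed (use w in \<open>simp add: short_words_def\<close>)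
  qed
  show "short_words n \<union> (\<Union>i\<in>branch_index n. branch i) \<subseteq> short_words (Suc n)"
    by (auto simp: short_words_def branch_index_def branch_def reduced_append)
qed

lemma dist_G_eq:
  assumes "u \<in> reduced_words A B" "v \<in> reduced_words A B"
  shows "dist_G u v = real (norm_G (inv\<^bsub>G\<^esub> u \<otimes>\<^bsub>G\<^esub> v))"
proof -
  interpret G: group G by (rule groups)
  have "inv\<^bsub>G\<^esub> u \<otimes>\<^bsub>G\<^esub> v \<in> reduced_words A B"
    using assms G.m_closed G.inv_closed unfolding carrier_free_product by blast
  then show ?thesis
    using assms groups(3) by (simp add: word_dist_eq carrier_free_product word_norm_free_product)
qed

lemma inv_letter:
  assumes "[x] \<in> reduced_words A B"
  obtains y where "inv\<^bsub>G\<^esub> [x] = [y]" "isl y = isl x"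
proof -
  interpret A: group A by (rule groups)
  interpret B: group B by (rule groups)
  interpret G: group G by (rule groups)
  show thesis
  proof (cases x)
    case (Inl a)
    with assms have "a \<in> carrier A" "a \<noteq> \<one>\<^bsub>A\<^esub>" by (auto simp: reduced_Cons)
    with inv_free_inl[of a] Inl that[of "Inl (inv\<^bsub>A\<^esub> a)"] show thesis
      by (simp add: free_inl_def)
  next
    case (Inr b)
    with assms have "b \<in> carrier B" "b \<noteq> \<one>\<^bsub>B\<^esub>" by (auto simp: reduced_Cons)
    with inv_free_inr[of b] Inr that[of "Inr (inv\<^bsub>B\<^esub> b)"] show thesis
      by (simp add: free_inr_def)
  qed
qed

text \<open>Write \<open>y\<close> as \<open>w\<close> times the syllable \<open>x\<close>, and
  \<open>g\<close> for the product of the inverse of \<open>w\<close> with \<open>z\<close>. Then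
  the inverse of \<open>y\<close> times \<open>z\<close> is the inverse of \<open>x\<close> followed
  by \<open>g\<close>. If \<open>g\<close> does not start in the factor of \<open>x\<close>, this
  word is reduced as it stands, and its norm is the sum of the norms of the two parts.\<close>

lemma dist_G_branch:
  assumes i: "i \<in> branch_index n" and y: "y \<in> branch i" and z: "z \<in> short_words (Suc n) - branch i"
  shows "dist_G y z = dist_G y (fst i) + dist_G (fst i) z"
proof -
  interpret G: group G by (rule groups)
  obtain w t where wt: "i = (w, t)" by (cases i)
  have w: "w \<in> reduced_words A B" "length w = n" "w = [] \<or> isl (last w) \<noteq> t"
    using i by (auto simp: wt branch_index_def)
  obtain x where x: "y = w @ [x]" "[x] \<in> reduced_words A B" "isl x = t"
    using y by (auto simp: wt branch_def)
  have red_y: "w @ [x] \<in> reduced_words A B" using w x by (auto simp: reduced_append)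
  have z': "z \<in> reduced_words A B" "length z \<le> Suc n" "z \<notin> branch i"
    using z by (auto simp: short_words_def)
  define g where "g = inv\<^bsub>G\<^esub> w \<otimes>\<^bsub>G\<^esub> z"
  note red = w(1)[folded carrier_free_product[of A B]] x(2)[folded carrier_free_product[of A B]]
    z'(1)[folded carrier_free_product[of A B]]
  have g: "g \<in> reduced_words A B"
    using G.m_closed[OF G.inv_closed[OF red(1)] red(3)] unfolding g_def carrier_free_product .
  have wg: "w \<otimes>\<^bsub>G\<^esub> g = z"
    unfolding g_def using red by (simp add: G.m_assoc[symmetric])
  \<comment> \<open>If \<open>g\<close> started in the factor \<open>t\<close>, then
    \<open>z\<close> would be \<open>w @ g\<close> without cancellation; its length, at most n + 1,
    leaves room for one syllable only, which puts \<open>z\<close> into the branch.\<close>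
  have hd_g: "g = [] \<or> isl (hd g) \<noteq> t"
  proof (rule ccontr)
    assume "\<not> ?thesis"
    then have *: "g \<noteq> []" "isl (hd g) = t" by auto
    then have "w @ g \<in> reduced_words A B" using w g by (auto simp: reduced_append)
    then have z_eq: "z = w @ g" using wg mult_reduced_append by metis
    then have "length g \<le> 1" using z'(2) w(2) by simp
    with * have "g = [hd g]" by (cases g) auto
    then have "z \<in> branch i" using z_eq g * unfolding wt branch_def by auto
    with z'(3) show False ..
  qed
  obtain x' where x': "inv\<^bsub>G\<^esub> [x] = [x']" "isl x' = isl x" using inv_letter[OF x(2)] .
  have red_x': "[x'] \<in> reduced_words A B"
    using G.inv_closed[OF red(2)] unfolding x' carrier_free_product .
  have y_eq: "y = w \<otimes>\<^bsub>G\<^esub> [x]" using mult_reduced_append[OF red_y] x(1) by simp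
  have inv_y: "inv\<^bsub>G\<^esub> y = [x'] \<otimes>\<^bsub>G\<^esub> inv\<^bsub>G\<^esub> w"
    unfolding y_eq using red x' by (simp add: G.inv_mult_group)
  have red_x'': "[x'] \<in> carrier G" using red_x' unfolding carrier_free_product .
  have "inv\<^bsub>G\<^esub> y \<otimes>\<^bsub>G\<^esub> z = [x'] \<otimes>\<^bsub>G\<^esub> g"
    unfolding inv_y g_def using red red_x'' by (simp add: G.m_assoc)
  also have "\<dots> = [x'] @ g"
    using hd_g x' x(3) g red_x' by (intro mult_reduced_append iffD2[OF reduced_append]) auto
  finally have yz: "inv\<^bsub>G\<^esub> y \<otimes>\<^bsub>G\<^esub> z = [x'] @ g" .
  have yw: "inv\<^bsub>G\<^esub> y \<otimes>\<^bsub>G\<^esub> w = [x']"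
    unfolding inv_y using red red_x'' by (simp add: G.m_assoc)
  show ?thesis
    using red_y z'(1) w(1) x(1) yz yw by (simp add: dist_G_eq wt g_def)
qed

text \<open>Left multiplication by \<open>w\<close> is an isometry, and on a factor the norm of the
  free product restricts to that of the factor, the norm of a single syllable. So a branch with its
  base point is an isometric copy of \<open>A\<close> or \<open>B\<close>, the base point
  corresponding to the identity.\<close>

lemma contractible_branch:
  assumes i: "i \<in> branch_index n"
    and contr: "contractible_space (realization (rips (carrier A) (word_dist A S_A) r))"
      "contractible_space (realization (rips (carrier B) (word_dist B S_B) r))"
  shows "contractible_space (realization (rips (insert (fst i) (branch i)) dist_G r))"
proof -
  interpret A: group A by (rule groups)
  interpret B: group B by (rule groups)
  interpret G: group G by (rule groups)
  obtain w t where wt: "i = (w, t)" by (cases i)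
  have w: "w \<in> reduced_words A B" "w = [] \<or> isl (last w) \<noteq> t"
    using i by (auto simp: wt branch_index_def)
  have wG: "w \<in> carrier G" using w(1) unfolding carrier_free_product .
  show ?thesis
  proof (cases t)
    case True
    have red: "w @ free_inl A a \<in> reduced_words A B" if "a \<in> carrier A" for a
      using w True that by (auto simp: free_inl_def reduced_append reduced_Cons)
    have "insert w (branch i) = (\<lambda>a. w @ free_inl A a) ` carrier A"
    proof
      show "insert w (branch i) \<subseteq> (\<lambda>a. w @ free_inl A a) ` carrier A"
      proof
        fix v assume "v \<in> insert w (branch i)"
        then consider "v = w" | x where "v = w @ [x]" "[x] \<in> reduced_words A B" "isl x"
          using True by (auto simp: wt branch_def)
        then show "v \<in> (\<lambda>a. w @ free_inl A a) ` carrier A"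
        proof cases
          case 1
          then show ?thesis by (intro image_eqI[of _ _ "\<one>\<^bsub>A\<^esub>"]) (simp_all add: free_inl_def)
        next
          case 2
          then obtain a where "x = Inl a" "a \<in> carrier A" "a \<noteq> \<one>\<^bsub>A\<^esub>"
            by (auto simp: reduced_Cons)
          with 2 show ?thesis by (intro image_eqI[of _ _ a]) (simp_all add: free_inl_def)
        qed
      qed
      show "(\<lambda>a. w @ free_inl A a) ` carrier A \<subseteq> insert w (branch i)"
        using True by (auto simp: wt branch_def free_inl_def reduced_Cons)
    qed
    moreover have "contractible_space (realization (rips ((\<lambda>a. w @ free_inl A a) ` carrier A) dist_G r))"
    proof (rule contractible_rips_isometric[OF _ _ contr(1)])
      show "inj_on (\<lambda>a. w @ free_inl A a) (carrier A)"
        using inj_free_inl[of A] by (auto simp: inj_on_def)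
      fix a a' assume a: "a \<in> carrier A" "a' \<in> carrier A"
      note fa = hom_in_carrier[OF homs(1) a(1)] hom_in_carrier[OF homs(1) a(2)]
      have "dist_G (w @ free_inl A a) (w @ free_inl A a') =
          dist_G (w \<otimes>\<^bsub>G\<^esub> free_inl A a) (w \<otimes>\<^bsub>G\<^esub> free_inl A a')"
        using red a by (simp add: mult_reduced_append)
      also have "\<dots> = dist_G (free_inl A a) (free_inl A a')"
        using word_dist_left_mult[OF groups(3) wG fa] .
      also have "\<dots> = real (norm_G (inv\<^bsub>G\<^esub> (free_inl A a) \<otimes>\<^bsub>G\<^esub> free_inl A a'))"
        using fa by (simp add: dist_G_eq carrier_free_product)
      also have "inv\<^bsub>G\<^esub> (free_inl A a) \<otimes>\<^bsub>G\<^esub> free_inl A a' = free_inl A (inv\<^bsub>A\<^esub> a \<otimes>\<^bsub>A\<^esub> a')"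
        using a hom_mult[OF homs(1), of "inv\<^bsub>A\<^esub> a" a'] by (simp add: inv_free_inl)
      finally show "dist_G (w @ free_inl A a) (w @ free_inl A a') = word_dist A S_A a a'"
        using a groups(1) by (simp add: word_dist_eq)
    qed
    ultimately show ?thesis by (simp add: wt)
  next
    case False
    have red: "w @ free_inr B b \<in> reduced_words A B" if "b \<in> carrier B" for b
      using w False that by (auto simp: free_inr_def reduced_append reduced_Cons)
    have "insert w (branch i) = (\<lambda>b. w @ free_inr B b) ` carrier B"
    proof
      show "insert w (branch i) \<subseteq> (\<lambda>b. w @ free_inr B b) ` carrier B"
      proof
        fix v assume "v \<in> insert w (branch i)"
        then consider "v = w" | x where "v = w @ [x]" "[x] \<in> reduced_words A B" "\<not> isl x"
          using False by (auto simp: wt branch_def)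
        then show "v \<in> (\<lambda>b. w @ free_inr B b) ` carrier B"
        proof cases
          case 1
          then show ?thesis by (intro image_eqI[of _ _ "\<one>\<^bsub>B\<^esub>"]) (simp_all add: free_inr_def)
        next
          case 2
          then obtain b where "x = Inr b" "b \<in> carrier B" "b \<noteq> \<one>\<^bsub>B\<^esub>"
            by (auto simp: reduced_Cons)
          with 2 show ?thesis by (intro image_eqI[of _ _ b]) (simp_all add: free_inr_def)
        qed
      qed
      show "(\<lambda>b. w @ free_inr B b) ` carrier B \<subseteq> insert w (branch i)"
        using False by (auto simp: wt branch_def free_inr_def reduced_Cons)
    qed
    moreover have "contractible_space (realization (rips ((\<lambda>b. w @ free_inr B b) ` carrier B) dist_G r))"
    proof (rule contractible_rips_isometric[OF _ _ contr(2)])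
      show "inj_on (\<lambda>b. w @ free_inr B b) (carrier B)"
        using inj_free_inr[of B] by (auto simp: inj_on_def)
      fix b b' assume b: "b \<in> carrier B" "b' \<in> carrier B"
      note fb = hom_in_carrier[OF homs(2) b(1)] hom_in_carrier[OF homs(2) b(2)]
      have "dist_G (w @ free_inr B b) (w @ free_inr B b') =
          dist_G (w \<otimes>\<^bsub>G\<^esub> free_inr B b) (w \<otimes>\<^bsub>G\<^esub> free_inr B b')"
        using red b by (simp add: mult_reduced_append)
      also have "\<dots> = dist_G (free_inr B b) (free_inr B b')"
        using word_dist_left_mult[OF groups(3) wG fb] .
      also have "\<dots> = real (norm_G (inv\<^bsub>G\<^esub> (free_inr B b) \<otimes>\<^bsub>G\<^esub> free_inr B b'))"
        using fb by (simp add: dist_G_eq carrier_free_product)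
      also have "inv\<^bsub>G\<^esub> (free_inr B b) \<otimes>\<^bsub>G\<^esub> free_inr B b' = free_inr B (inv\<^bsub>B\<^esub> b \<otimes>\<^bsub>B\<^esub> b')"
        using b hom_mult[OF homs(2), of "inv\<^bsub>B\<^esub> b" b'] by (simp add: inv_free_inr)
      finally show "dist_G (w @ free_inr B b) (w @ free_inr B b') = word_dist B S_B b b'"
        using b groups(2) by (simp add: word_dist_eq)
    qed
    ultimately show ?thesis by (simp add: wt)
  qed
qed

lemma contractible_rips_free_product:
  assumes r: "0 \<le> r"
    and contr: "contractible_space (realization (rips (carrier A) (word_dist A S_A) r))"
      "contractible_space (realization (rips (carrier B) (word_dist B S_B) r))"
  shows "contractible_space (realization (rips (carrier G) dist_G r))"
proof -
  let ?K = "\<lambda>n. rips (short_words n) dist_G r"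
  have mono: "?K n \<subseteq> ?K (Suc n)" for n
    by (rule rips_mono) (auto simp: short_words_def)
  have red: "w \<in> reduced_words A B" if "w \<in> short_words n" for w n
    using that by (simp add: short_words_def)
  have "contractible_space (realization (\<Union>n. ?K n))"
  proof (rule contractible_realization_Union[where K = ?K, OF mono])
    fix n
    show "subtopology (realization (?K (Suc n))) (\<Union>\<sigma>\<in>?K n. face \<sigma>) = realization (?K n)"
      by (rule subtopology_realization[OF abstract_complex_rips abstract_complex_rips mono])
    show "deforms (realization (?K (Suc n))) (\<Union>\<sigma>\<in>?K n. face \<sigma>) (\<Union>\<sigma>\<in>?K n. face \<sigma>)"
    proof (rule deforms_rips[where b = fst, OF _ _ _ r short_words_Suc])
      fix u v assume "u \<in> short_words (Suc n)" "v \<in> short_words (Suc n)"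
      then show "dist_G u v = dist_G v u"
        using word_dist_commute[OF marked_group_free_product] red
        unfolding carrier_free_product by blast
      show "0 \<le> dist_G u v" by (simp add: word_dist_def)
    next
      show "dist_G u u = 0" for u by (simp add: word_dist_def)
    next
      fix i j assume "i \<in> branch_index n" "j \<in> branch_index n" "i \<noteq> j"
      then show "branch i \<inter> branch j = {}" by (auto simp: branch_def prod_eq_iff)
    next
      fix i assume i: "i \<in> branch_index n"
      then show "short_words n \<inter> branch i = {}"
        by (auto simp: short_words_def branch_def branch_index_def)
      show "fst i \<in> short_words n" using i by (auto simp: short_words_def branch_index_def)
      show "contractible_space (realization (rips (insert (fst i) (branch i)) dist_G r))"
        by (rule contractible_branch[OF i contr])
      show "dist_G y z = dist_G y (fst i) + dist_G (fst i) z"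
        if "y \<in> branch i" "z \<in> short_words (Suc n) - branch i" for y z
        by (rule dist_G_branch[OF i that])
    qed
  next
    have "short_words 0 = {[]}" by (auto simp: short_words_def)
    moreover have "\<sigma> = {[]}" if "\<sigma> \<in> rips {[]} dist_G r" for \<sigma>
      using that unfolding rips_iff by (metis subset_singletonD)
    moreover have "{[]} \<in> rips {[]} dist_G r" using r by (simp add: rips_iff word_dist_def)
    ultimately have "?K 0 = {{[]}}" by auto
    then show "(\<Union>\<sigma>\<in>?K 0. face \<sigma>) = {\<lambda>w. if w = [] then 1 else 0}"
      by (simp add: face_singleton)
  qed
  moreover have "(\<Union>n. ?K n) = rips (carrier G) dist_G r"
  proof
    show "(\<Union>n. ?K n) \<subseteq> rips (carrier G) dist_G r"
      unfolding carrier_free_product using red by (intro UN_least rips_mono) blast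
    show "rips (carrier G) dist_G r \<subseteq> (\<Union>n. ?K n)"
    proof
      fix \<sigma> assume \<sigma>: "\<sigma> \<in> rips (carrier G) dist_G r"
      then have "finite \<sigma>" "\<sigma> \<subseteq> reduced_words A B"
        by (simp_all add: rips_iff carrier_free_product)
      \<comment> \<open>A simplex is finite, so the syllable lengths of its vertices are bounded and
        it appears at a finite stage.\<close>
      then have "\<sigma> \<subseteq> short_words (Max (length ` \<sigma>))" by (auto simp: short_words_def)
      then have "\<sigma> \<in> ?K (Max (length ` \<sigma>))" using \<sigma> by (simp add: rips_iff)
      then show "\<sigma> \<in> (\<Union>n. ?K n)" by blast
    qed
  qed
  ultimately show ?thesis by simp
qed

end

theorem corollary3p1:
  fixes A :: "('a, 'm) monoid_scheme" and B :: "('b, 'n) monoid_scheme"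
    and S_A :: "'a set" and S_B :: "'b set"
  assumes "type_R A S_A" and "type_R B S_B"
  shows "type_R (free_product A B) (free_inl A ` S_A \<union> free_inr B ` S_B)"
proof -
  interpret marked_free_product A B S_A S_B
    using assms by unfold_locales (simp_all add: type_R_def)
  obtain r\<^sub>A r\<^sub>B where "0 \<le> r\<^sub>A" "0 \<le> r\<^sub>B"
    and "\<forall>r\<ge>r\<^sub>A. contractible_space (realization (rips (carrier A) (word_dist A S_A) r))"
    and "\<forall>r\<ge>r\<^sub>B. contractible_space (realization (rips (carrier B) (word_dist B S_B) r))"
    using assms unfolding type_R_def by blast
  then have "\<forall>r\<ge>max r\<^sub>A r\<^sub>B. contractible_space (realization (rips (carrier G) dist_G r))"
    using contractible_rips_free_product by simp
  then show ?thesis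
    unfolding type_R_def using marked_group_free_product \<open>0 \<le> r\<^sub>A\<close> by (meson max.coboundedI1)
qed

end
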